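(* Let $r\in\mathbb{N}$ and let $f\in\mathcal{K}'_{M,r}(\mathbb{R}^n)$ (resp. $f\in\mathcal{S}'_r(\mathbb{R}^n)$). Suppose that $f(\mathbf{x}_0)=\gamma$ distributionally of order $\le r$ at a point $\mathbf{x}_0\in\mathbb{R}^n$. Then $\lim_{\varepsilon\to0}f(\mathbf{x}_0+\varepsilon\mathbf{x})=\gamma$ strongly in $\mathcal{K}'_{M,r}(\mathbb{R}^n)$ (resp. in $\mathcal{S}'_r(\mathbb{R}^n)$); that is, the limit $$\lim_{\varepsilon\to0}\langle f(\mathbf{x}_0+\varepsilon\mathbf{x}),\varphi(\mathbf{x})\rangle=\gamma\int_{\mathbb{R}^n}\varphi(\mathbf{x})\,d\mathbf{x}$$ holds uniformly for $\varphi$ in bounded subsets of $\mathcal{K}_{M,r}(\mathbb{R}^n)$ (resp. of $\mathcal{S}_r(\mathbb{R}^n)$).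
   Context: $\mathbb{N}=\{0,1,2,\dots\}$. $M:[0,\infty)\to[0,\infty)$ is a continuous increasing function with $M(t)+M(s)\le M(t+s)$ and $M(t+s)\le M(2t)+M(2s)$ for all $t,s\ge0$; write $M(\mathbf{x})=M(|\mathbf{x}|)$ for $\mathbf{x}\in\mathbb{R}^n$. $\mathcal{K}_{M,r}(\mathbb{R}^n)$ is the Fréchet space of all $\varphi\in C^r(\mathbb{R}^n)$ such that for every $l\in\mathbb{N}$ the norm $\nu_{r,l}(\varphi)=\sup_{|\alpha|\le r,\,\mathbf{x}\in\mathbb{R}^n}e^{M(l\mathbf{x})}|\varphi^{(\alpha)}(\mathbf{x})|$ is finite, topologized by these norms. $\mathcal{S}_r(\mathbb{R}^n)$ is the Fréchet space of all $\varphi\in C^r(\mathbb{R}^n)$ such that for every $l\in\mathbb{N}$ the norm $\rho_{r,l}(\varphi)=\sup_{|\alpha|\le r,\,\mathbf{x}\in\mathbb{R}^n}(1+|\mathbf{x}|)^l|\varphi^{(\alpha)}(\mathbf{x})|$ is finite, topologized by these norms. In both, $\mathcal{D}(\mathbb{R}^n)$ is dense. $\mathcal{K}'_{M,r}$ and $\mathcal{S}'_r$ are the duals (spaces of distributions). $\langle f(\mathbf{x}_0+\varepsilon\mathbf{x}),\varphi(\mathbf{x})\rangle=|\varepsilon|^{-n}\langle f(\mathbf{y}),\varphi((\mathbf{y}-\mathbf{x}_0)/\varepsilon)\rangle$. A distribution $f$ has distributional point value $\gamma$ at $\mathbf{x}_0$ ("$f(\mathbf{x}_0)=\gamma$ distributionally")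 if $\lim_{\varepsilon\to0}\langle f(\mathbf{x}_0+\varepsilon\mathbf{x}),\varphi(\mathbf{x})\rangle=\gamma\int_{\mathbb{R}^n}\varphi(\mathbf{x})\,d\mathbf{x}$ for all $\varphi\in\mathcal{D}(\mathbb{R}^n)$. The point value is of order $\le r$ if this limit holds uniformly for $\varphi$ in bounded subsets of $\mathcal{D}^r(\mathbb{R}^n)$, the space of compactly supported $C^r$ functions (bounded: supports in a common compact set, and all derivatives of order $\le r$ uniformly bounded). *)

theory Defs
  imports "HOL-Analysis.Analysis"
begin

section \<open>Functions of class \<open>C\<^sup>r\<close> and their derivatives\<close>

definition partial_deriv ::
    "'n::finite \<Rightarrow> (real^'n \<Rightarrow> complex) \<Rightarrow> real^'n \<Rightarrow> complex" where
  "partial_deriv i \<phi> x = frechet_derivative \<phi> (at x) (axis i 1)"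

fun C_r :: "nat \<Rightarrow> (real^'n::finite \<Rightarrow> complex) \<Rightarrow> bool" where
  "C_r 0 \<phi> \<longleftrightarrow> continuous_on UNIV \<phi>"
| "C_r (Suc r) \<phi> \<longleftrightarrow> (\<forall>x. \<phi> differentiable (at x)) \<and> (\<forall>i. C_r r (partial_deriv i \<phi>))"

text \<open>
  A multi-index is a function \<open>\<alpha> :: 'n \<Rightarrow> nat\<close>, and the derivative \<open>\<phi>\<^sup>(\<^sup>\<alpha>\<^sup>)\<close> is the composition of the
  \<open>\<alpha> i\<close>-fold partial derivatives. The index type carries no order, so the coordinates are taken in
  the order of an arbitrary but fixed enumeration. For \<open>\<phi>\<close> of class \<open>C\<^sup>r\<close> and \<open>\<bar>\<alpha>\<bar> \<le> r\<close>, the only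
  case used below, the result does not depend on the enumeration (symmetry of mixed partial
  derivatives).
\<close>

definition coordinates :: "'n::finite list" where
  "coordinates = (SOME is. distinct is \<and> set is = UNIV)"

definition multi_deriv ::
    "('n::finite \<Rightarrow> nat) \<Rightarrow> (real^'n \<Rightarrow> complex) \<Rightarrow> real^'n \<Rightarrow> complex" where
  "multi_deriv \<alpha> \<phi> = foldr (\<lambda>i. partial_deriv i ^^ \<alpha> i) coordinates \<phi>"

definition multi_indices :: "nat \<Rightarrow> ('n::finite \<Rightarrow> nat) set" where
  "multi_indices r = {\<alpha>. (\<Sum>i\<in>UNIV. \<alpha> i) \<le> r}"


section \<open>Spaces topologized by a sequence of norms\<close>

definition norms_topology ::
    "(real^'n \<Rightarrow> complex) set \<Rightarrow> (nat \<Rightarrow> (real^'n::finite \<Rightarrow> complex) \<Rightarrow> real)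
      \<Rightarrow> (real^'n \<Rightarrow> complex) topology" where
  "norms_topology X p = topology_generated_by
     {{\<psi>\<in>X. p l (\<lambda>x. \<psi> x - \<phi> x) < e} | l \<phi> e. \<phi> \<in> X \<and> e > 0}"

definition norms_bounded ::
    "(real^'n \<Rightarrow> complex) set \<Rightarrow> (nat \<Rightarrow> (real^'n::finite \<Rightarrow> complex) \<Rightarrow> real)
      \<Rightarrow> (real^'n \<Rightarrow> complex) set \<Rightarrow> bool" where
  "norms_bounded X p B \<longleftrightarrow> B \<subseteq> X \<and> (\<forall>l. bdd_above (p l ` B))"

text \<open>Elements of the dual are total functions in HOL; their values outside \<open>X\<close> are irrelevant.\<close>

definition norms_dual ::
    "(real^'n \<Rightarrow> complex) set \<Rightarrow> (nat \<Rightarrow> (real^'n::finite \<Rightarrow> complex) \<Rightarrow> real)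
      \<Rightarrow> ((real^'n \<Rightarrow> complex) \<Rightarrow> complex) set" where
  "norms_dual X p = {f.
     (\<forall>\<phi>\<in>X. \<forall>\<psi>\<in>X. f (\<lambda>x. \<phi> x + \<psi> x) = f \<phi> + f \<psi>) \<and>
     (\<forall>c. \<forall>\<phi>\<in>X. f (\<lambda>x. c * \<phi> x) = c * f \<phi>) \<and>
     continuous_map (norms_topology X p) euclidean f}"


section \<open>The spaces \<open>\<K>\<^sub>M\<^sub>,\<^sub>r\<close> and \<open>\<S>\<^sub>r\<close>\<close>

text \<open>
  ``Increasing'' is read in the weak sense. The only nondecreasing \<open>M\<close> satisfying the two
  inequalities for which compactly supported smooth functions are not dense in \<open>\<K>\<^sub>M\<^sub>,\<^sub>r\<close> is \<open>M = 0\<close>,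
  so it is excluded by the last clause. A strictly increasing \<open>M\<close> satisfies that clause
  automatically.
\<close>

definition weight_function :: "(real \<Rightarrow> real) \<Rightarrow> bool" where
  "weight_function M \<longleftrightarrow>
     (\<forall>t\<ge>0. M t \<ge> 0) \<and>
     continuous_on {0..} M \<and>
     mono_on {0..} M \<and>
     (\<forall>t\<ge>0. \<forall>s\<ge>0. M t + M s \<le> M (t + s)) \<and>
     (\<forall>t\<ge>0. \<forall>s\<ge>0. M (t + s) \<le> M (2 * t) + M (2 * s)) \<and>
     (\<exists>t\<ge>0. M t \<noteq> 0)"

definition weighted_values ::
    "(real^'n \<Rightarrow> real) \<Rightarrow> nat \<Rightarrow> (real^'n::finite \<Rightarrow> complex) \<Rightarrow> real set" where
  "weighted_values w r \<phi> = {w x * cmod (multi_deriv \<alpha> \<phi> x) | \<alpha> x. \<alpha> \<in> multi_indices r}"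

text \<open>
  The norms below are real-valued suprema, meaningful only when the set of values is bounded above;
  the spaces require this explicitly.
\<close>

definition K_weight :: "(real \<Rightarrow> real) \<Rightarrow> nat \<Rightarrow> real^'n::finite \<Rightarrow> real" where
  "K_weight M l x = exp (M (norm (real l *\<^sub>R x)))"

definition K_norm :: "(real \<Rightarrow> real) \<Rightarrow> nat \<Rightarrow> nat \<Rightarrow> (real^'n::finite \<Rightarrow> complex) \<Rightarrow> real" where
  "K_norm M r l \<phi> = Sup (weighted_values (K_weight M l) r \<phi>)"

definition K_space :: "(real \<Rightarrow> real) \<Rightarrow> nat \<Rightarrow> (real^'n::finite \<Rightarrow> complex) set" where
  "K_space M r = {\<phi>. C_r r \<phi> \<and> (\<forall>l. bdd_above (weighted_values (K_weight M l) r \<phi>))}"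

definition S_weight :: "nat \<Rightarrow> real^'n::finite \<Rightarrow> real" where
  "S_weight l x = (1 + norm x) ^ l"

definition S_norm :: "nat \<Rightarrow> nat \<Rightarrow> (real^'n::finite \<Rightarrow> complex) \<Rightarrow> real" where
  "S_norm r l \<phi> = Sup (weighted_values (S_weight l) r \<phi>)"

definition S_space :: "nat \<Rightarrow> (real^'n::finite \<Rightarrow> complex) set" where
  "S_space r = {\<phi>. C_r r \<phi> \<and> (\<forall>l. bdd_above (weighted_values (S_weight l) r \<phi>))}"

abbreviation K_dual ::
    "(real \<Rightarrow> real) \<Rightarrow> nat \<Rightarrow> ((real^'n::finite \<Rightarrow> complex) \<Rightarrow> complex) set" where
  "K_dual M r \<equiv> norms_dual (K_space M r) (K_norm M r)"

abbreviation S_dual :: "nat \<Rightarrow> ((real^'n::finite \<Rightarrow> complex) \<Rightarrow> complex) set" where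
  "S_dual r \<equiv> norms_dual (S_space r) (S_norm r)"


section \<open>Distributional point values\<close>

definition supp :: "(real^'n::finite \<Rightarrow> complex) \<Rightarrow> (real^'n) set" where
  "supp \<phi> = closure {x. \<phi> x \<noteq> 0}"

definition D_r_space :: "nat \<Rightarrow> (real^'n::finite \<Rightarrow> complex) set" where
  "D_r_space r = {\<phi>. C_r r \<phi> \<and> compact (supp \<phi>)}"

definition D_space :: "(real^'n::finite \<Rightarrow> complex) set" where
  "D_space = {\<phi>. (\<forall>k. C_r k \<phi>) \<and> compact (supp \<phi>)}"

definition D_r_bounded :: "nat \<Rightarrow> (real^'n::finite \<Rightarrow> complex) set \<Rightarrow> bool" where
  "D_r_bounded r B \<longleftrightarrow> B \<subseteq> D_r_space r \<and>
     (\<exists>K. compact K \<and> (\<forall>\<phi>\<in>B. supp \<phi> \<subseteq> K)) \<and>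
     (\<exists>C. \<forall>\<phi>\<in>B. \<forall>\<alpha>\<in>multi_indices r. \<forall>x. cmod (multi_deriv \<alpha> \<phi> x) \<le> C)"

text \<open>\<open>dilate f x\<^sub>0 \<epsilon>\<close> is the functional written \<open>f (x\<^sub>0 + \<epsilon> x)\<close>, for \<open>\<epsilon> \<noteq> 0\<close> of either sign.\<close>

definition dilate ::
    "((real^'n::finite \<Rightarrow> complex) \<Rightarrow> complex) \<Rightarrow> real^'n \<Rightarrow> real
      \<Rightarrow> (real^'n \<Rightarrow> complex) \<Rightarrow> complex" where
  "dilate f x\<^sub>0 \<epsilon> \<phi> =
     of_real (1 / \<bar>\<epsilon>\<bar> ^ CARD('n)) * f (\<lambda>y. \<phi> ((1 / \<epsilon>) *\<^sub>R (y - x\<^sub>0)))"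

definition constant_functional ::
    "complex \<Rightarrow> (real^'n::finite \<Rightarrow> complex) \<Rightarrow> complex" where
  "constant_functional \<gamma> \<phi> = \<gamma> * (LINT x|lborel. \<phi> x)"

definition has_point_value ::
    "((real^'n::finite \<Rightarrow> complex) \<Rightarrow> complex) \<Rightarrow> real^'n \<Rightarrow> complex \<Rightarrow> bool" where
  "has_point_value f x\<^sub>0 \<gamma> \<longleftrightarrow>
     (\<forall>\<phi>\<in>D_space. ((\<lambda>\<epsilon>. dilate f x\<^sub>0 \<epsilon> \<phi>) \<longlongrightarrow> constant_functional \<gamma> \<phi>) (at 0))"

definition has_point_value_of_order ::
    "nat \<Rightarrow> ((real^'n::finite \<Rightarrow> complex) \<Rightarrow> complex) \<Rightarrow> real^'n \<Rightarrow> complex \<Rightarrow> bool" where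
  "has_point_value_of_order r f x\<^sub>0 \<gamma> \<longleftrightarrow> has_point_value f x\<^sub>0 \<gamma> \<and>
     (\<forall>B. D_r_bounded r B \<longrightarrow> uniform_limit B (dilate f x\<^sub>0) (constant_functional \<gamma>) (at 0))"

end

(*
  After subtracting the constant functional, gamma = 0. Let T_eps denote the dilated functional and
  eta a C^r cutoff that is 1 on the unit ball and 0 outside the ball of radius 2. Given delta, choose
  J with 2^J |eps| <= delta < 2^(J+1) |eps| and split phi into phi eta(x / 2^J) and the rest.

  Telescoping the first part over dyadic annuli and rescaling by 2^j turns the j-th piece into 2^(-j)
  times T_(2^j eps) of a function that, by the decay of phi, runs through a bounded subset of D^r.
  The point value condition therefore makes each piece small uniformly and summably in j. The rest
  lives on |x| >= 2^J, which is comparable to 1 / |eps|, and there the decay of phi beats the powers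
  of 1 / |eps| in the continuity estimate for the functional.
*)

theory Submission
  imports Defs "HOL-Library.Sublist" "HOL-Probability.Sinc_Integral"
begin

section \<open>Iterated partial derivatives\<close>

text \<open>The obstacle: a bounded set of \<open>K_space\<close> or \<open>S_space\<close> has no
  common compact support, while the hypothesis tests only functions that have one; and
  \<open>dilate\<close> costs |\<epsilon>|^-n by definition and up to |\<epsilon>|^-r by the chain
  rule. Two exponents settle the balance, with n the dimension. The multiplier q^(n+1) put on an
  annulus of scale q pays the Jacobian q^n and leaves one spare q, which is the source of the gain
  1/q. Decay of order n+1+r pays for this multiplier and for r derivatives of a function rescaled by
  q; far out it beats |\<epsilon>|^-(n+r) by exactly one power of |\<epsilon>|. Both spaces supply
  decay of every polynomial order that is stable under translation and contraction, and the locale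
  \<open>weight_family\<close> records this. For the weights exp(M) it rests on superadditivity,
  which makes a nonzero \<open>M\<close> grow at least linearly. Subtracting the constant functional
  is harmless because it is invariant under \<open>dilate\<close> and continuous on both
  spaces.\<close>

lemma has_derivative_partial_deriv:
  assumes "(\<phi> has_derivative D) (at x)"
  shows "partial_deriv i \<phi> x = D (axis i 1)"
  using frechet_derivative_at[OF assms] by (simp add: partial_deriv_def)

lemma C_r_SucD: "C_r (Suc r) \<phi> \<Longrightarrow> C_r r \<phi>"
proof (induction r arbitrary: \<phi>)
  case 0
  then show ?case
    by (auto intro!: continuous_at_imp_continuous_on differentiable_imp_continuous_within)
qed auto

lemma C_r_mono: "C_r s \<phi> \<Longrightarrow> r \<le> s \<Longrightarrow> C_r r \<phi>"
  by (induction s) (auto simp: le_Suc_eq dest: C_r_SucD simp del: C_r.simps)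

lemma C_r_continuous: "C_r r \<phi> \<Longrightarrow> continuous_on UNIV \<phi>"
  using C_r_mono[of r \<phi> 0] by simp

lemma C_r_const: "C_r r (\<lambda>x. c)"
proof (induction r arbitrary: c)
  case (Suc r)
  have "partial_deriv i (\<lambda>x. c) = (\<lambda>x. 0)" for i :: 'a
    by (rule ext, rule has_derivative_partial_deriv[OF has_derivative_const])
  then show ?case using Suc by simp
qed simp

lemma partial_deriv_add:
  assumes "C_r (Suc r) \<phi>" "C_r (Suc r) \<psi>"
  shows "partial_deriv i (\<lambda>x. \<phi> x + \<psi> x) = (\<lambda>x. partial_deriv i \<phi> x + partial_deriv i \<psi> x)"
proof
  fix x
  have "\<phi> differentiable (at x)" "\<psi> differentiable (at x)" using assms by auto
  then show "partial_deriv i (\<lambda>x. \<phi> x + \<psi> x) x = partial_deriv i \<phi> x + partial_deriv i \<psi> x"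
    by (subst has_derivative_partial_deriv[OF has_derivative_add])
      (auto simp: partial_deriv_def frechet_derivative_works)
qed

lemma C_r_add: "C_r r \<phi> \<Longrightarrow> C_r r \<psi> \<Longrightarrow> C_r r (\<lambda>x. \<phi> x + \<psi> x)"
proof (induction r arbitrary: \<phi> \<psi>)
  case (Suc r)
  then show ?case
    by (simp add: partial_deriv_add[OF Suc.prems] differentiable_add)
qed (auto intro: continuous_on_add)

lemma partial_deriv_mult:
  assumes "C_r (Suc r) \<phi>" "C_r (Suc r) \<psi>"
  shows "partial_deriv i (\<lambda>x. \<phi> x * \<psi> x) =
    (\<lambda>x. partial_deriv i \<phi> x * \<psi> x + \<phi> x * partial_deriv i \<psi> x)"
proof
  fix x
  have "\<phi> differentiable (at x)" "\<psi> differentiable (at x)" using assms by auto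
  then show "partial_deriv i (\<lambda>x. \<phi> x * \<psi> x) x
      = partial_deriv i \<phi> x * \<psi> x + \<phi> x * partial_deriv i \<psi> x"
    by (subst has_derivative_partial_deriv[OF has_derivative_mult])
      (auto simp: partial_deriv_def frechet_derivative_works)
qed

lemma C_r_mult: "C_r r \<phi> \<Longrightarrow> C_r r \<psi> \<Longrightarrow> C_r r (\<lambda>x. \<phi> x * \<psi> x)"
proof (induction r arbitrary: \<phi> \<psi>)
  case (Suc r)
  note C = C_r_SucD[OF Suc.prems(1)] C_r_SucD[OF Suc.prems(2)]
  have "C_r r (partial_deriv i (\<lambda>x. \<phi> x * \<psi> x))" for i
    using Suc C by (simp add: partial_deriv_mult[OF Suc.prems] C_r_add)
  then show ?case using Suc.prems by (auto intro: differentiable_mult)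
qed (auto intro: continuous_on_mult)

lemma partial_deriv_cmult:
  assumes "C_r (Suc r) \<phi>"
  shows "partial_deriv i (\<lambda>x. c * \<phi> x) = (\<lambda>x. c * partial_deriv i \<phi> x)"
proof
  fix x
  have "\<phi> differentiable (at x)" using assms by auto
  then show "partial_deriv i (\<lambda>x. c * \<phi> x) x = c * partial_deriv i \<phi> x"
    by (subst has_derivative_partial_deriv[OF has_derivative_mult_right])
      (auto simp: partial_deriv_def frechet_derivative_works)
qed

lemma C_r_cmult: "C_r r \<phi> \<Longrightarrow> C_r r (\<lambda>x. c * \<phi> x)"
  by (intro C_r_mult C_r_const)

lemma C_r_diff: "C_r r \<phi> \<Longrightarrow> C_r r \<psi> \<Longrightarrow> C_r r (\<lambda>x. \<phi> x - \<psi> x)"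
  using C_r_add[of r \<phi> "\<lambda>x. -1 * \<psi> x"] C_r_cmult[of r \<psi> "-1"] by simp

lemma C_r_sum: "finite A \<Longrightarrow> (\<And>a. a \<in> A \<Longrightarrow> C_r r (\<phi> a)) \<Longrightarrow> C_r r (\<lambda>x. \<Sum>a\<in>A. \<phi> a x)"
  by (induction rule: finite_induct) (auto intro: C_r_add C_r_const)

lemma has_derivative_affine:
  fixes \<phi> :: "real^'n::finite \<Rightarrow> complex"
  assumes "\<phi> differentiable (at (c *\<^sub>R x + b))"
  shows "((\<lambda>x. \<phi> (c *\<^sub>R x + b)) has_derivative
    (\<lambda>h. frechet_derivative \<phi> (at (c *\<^sub>R x + b)) (c *\<^sub>R h))) (at x)"
proof -
  have "((\<lambda>x. c *\<^sub>R x + b) has_derivative (\<lambda>h. c *\<^sub>R h)) (at x)"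
    by (auto intro!: derivative_eq_intros)
  moreover have "(\<phi> has_derivative frechet_derivative \<phi> (at (c *\<^sub>R x + b))) (at (c *\<^sub>R x + b))"
    using assms frechet_derivative_works by blast
  ultimately show ?thesis by (rule has_derivative_compose)
qed

lemma partial_deriv_affine:
  assumes "C_r (Suc r) \<phi>"
  shows "partial_deriv i (\<lambda>x. \<phi> (c *\<^sub>R x + b)) = (\<lambda>x. of_real c * partial_deriv i \<phi> (c *\<^sub>R x + b))"
proof
  fix x
  have d: "\<phi> differentiable (at (c *\<^sub>R x + b))" using assms by auto
  then have l: "linear (frechet_derivative \<phi> (at (c *\<^sub>R x + b)))"
    by (rule linear_frechet_derivative)
  show "partial_deriv i (\<lambda>x. \<phi> (c *\<^sub>R x + b)) x = of_real c * partial_deriv i \<phi> (c *\<^sub>R x + b)"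
    unfolding has_derivative_partial_deriv[OF has_derivative_affine[OF d]]
    by (simp only: partial_deriv_def linear_cmul[OF l] scaleR_conv_of_real[where 'a=complex])
qed

lemma C_r_affine: "C_r r \<phi> \<Longrightarrow> C_r r (\<lambda>x. \<phi> (c *\<^sub>R x + b))"
proof (induction r arbitrary: \<phi>)
  case 0
  then have "continuous_on UNIV \<phi>" by simp
  then show ?case
    unfolding C_r.simps
    by (rule continuous_on_compose2[of UNIV \<phi> UNIV]) (auto intro!: continuous_intros)
next
  case (Suc r)
  have "C_r r (partial_deriv i (\<lambda>x. \<phi> (c *\<^sub>R x + b)))" for i
  proof -
    have "C_r r (partial_deriv i \<phi>)" using Suc.prems by simp
    from C_r_cmult[OF Suc.IH[OF this]] show ?thesis unfolding partial_deriv_affine[OF Suc.prems] .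
  qed
  then show ?case
    using Suc.prems has_derivative_affine[of \<phi> c _ b] by (auto simp: differentiable_def)
qed

text \<open>A list keeps the order of differentiation, its last entry acting first. Inductions
  therefore strip the last entry (\<open>rev_induct\<close>), in step with the recursion of
  \<open>C_r\<close>.\<close>

definition partial_derivs ::
    "'n::finite list \<Rightarrow> (real^'n \<Rightarrow> complex) \<Rightarrow> real^'n \<Rightarrow> complex" where
  "partial_derivs js \<phi> = foldr partial_deriv js \<phi>"

lemma partial_derivs_Nil [simp]: "partial_derivs [] \<phi> = \<phi>"
  by (simp add: partial_derivs_def)

lemma partial_derivs_snoc [simp]:
  "partial_derivs (js @ [i]) \<phi> = partial_derivs js (partial_deriv i \<phi>)"
  by (simp add: partial_derivs_def)

lemma continuous_partial_derivs:
  "C_r r \<phi> \<Longrightarrow> length js \<le> r \<Longrightarrow> continuous_on UNIV (partial_derivs js \<phi>)"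
proof (induction js arbitrary: r \<phi> rule: rev_induct)
  case Nil then show ?case by (simp add: C_r_continuous)
next
  case (snoc i js)
  then obtain s where "r = Suc s" by (cases r) auto
  with snoc show ?case by auto
qed

lemma partial_derivs_add:
  "C_r r \<phi> \<Longrightarrow> C_r r \<psi> \<Longrightarrow> length js \<le> r \<Longrightarrow>
    partial_derivs js (\<lambda>x. \<phi> x + \<psi> x) x = partial_derivs js \<phi> x + partial_derivs js \<psi> x"
proof (induction js arbitrary: r \<phi> \<psi> rule: rev_induct)
  case (snoc i js)
  then obtain s where [simp]: "r = Suc s" by (cases r) auto
  show ?case using snoc.IH[of s] snoc.prems by (simp add: partial_deriv_add[of s] del: C_r.simps) simp
qed simp

lemma partial_derivs_cmult:
  "C_r r \<phi> \<Longrightarrow> length js \<le> r \<Longrightarrow> partial_derivs js (\<lambda>x. c * \<phi> x) x = c * partial_derivs js \<phi> x"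
proof (induction js arbitrary: r \<phi> rule: rev_induct)
  case (snoc i js)
  then obtain s where [simp]: "r = Suc s" by (cases r) auto
  show ?case using snoc.IH[of s] snoc.prems by (simp add: partial_deriv_cmult[of s] del: C_r.simps) simp
qed simp

lemma partial_derivs_affine:
  "C_r r \<phi> \<Longrightarrow> length js \<le> r \<Longrightarrow>
    partial_derivs js (\<lambda>x. \<phi> (c *\<^sub>R x + b)) x = of_real c ^ length js * partial_derivs js \<phi> (c *\<^sub>R x + b)"
proof (induction js arbitrary: r \<phi> rule: rev_induct)
  case (snoc i js)
  then obtain s where [simp]: "r = Suc s" by (cases r) auto
  have C: "C_r s (partial_deriv i \<phi>)" using snoc.prems by auto
  have "partial_derivs js (\<lambda>x. of_real c * partial_deriv i \<phi> (c *\<^sub>R x + b)) x =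
     of_real c * (of_real c ^ length js * partial_derivs js (partial_deriv i \<phi>) (c *\<^sub>R x + b))"
    using snoc.IH[OF C] C_r_affine[OF C] snoc.prems by (subst partial_derivs_cmult[of s]) auto
  then show ?case using snoc.prems by (simp add: partial_deriv_affine[of s] del: C_r.simps)
qed simp

lemma partial_derivs_const: "length js \<noteq> 0 \<Longrightarrow> partial_derivs js (\<lambda>x. c) x = 0"
proof -
  have *: "partial_derivs js (\<lambda>x. 0) x = 0" for js and x :: "real^'n"
    using partial_derivs_cmult[OF C_r_const le_refl, of js 0 0 x] by simp
  assume "length js \<noteq> 0"
  then obtain i ks where "js = ks @ [i]" by (cases js rule: rev_cases) auto
  moreover have "partial_deriv i (\<lambda>x. c) = (\<lambda>x. 0)"
    by (rule ext, rule has_derivative_partial_deriv[OF has_derivative_const])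
  ultimately show ?thesis by (simp add: *)
qed

lemma partial_derivs_eq_0_on_open:
  "open U \<Longrightarrow> (\<And>x. x \<in> U \<Longrightarrow> \<phi> x = 0) \<Longrightarrow> x \<in> U \<Longrightarrow> partial_derivs js \<phi> x = 0"
proof (induction js arbitrary: \<phi> rule: rev_induct)
  case (snoc i js)
  have "partial_deriv i \<phi> y = 0" if "y \<in> U" for y
  proof -
    have "(\<phi> has_derivative (\<lambda>h. 0)) (at y)"
      using has_derivative_const[of "0::complex" "at y"] snoc.prems(1) that
      by (rule has_derivative_transform_within_open) (simp add: snoc.prems(2))
    then show ?thesis by (rule has_derivative_partial_deriv)
  qed
  then show ?case using snoc by simp
qed simp

text \<open>
  Every term of the expanded product applies to each factor a
  subsequence of the given list of directions, so symmetry of mixed derivatives is not needed.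
\<close>

lemma partial_derivs_mult_bound:
  assumes "C_r r \<phi>" "C_r r \<psi>" "length js \<le> r"
    and "\<And>ks. subseq ks js \<Longrightarrow> cmod (partial_derivs ks \<phi> x) \<le> A"
    and "\<And>ks. subseq ks js \<Longrightarrow> cmod (partial_derivs ks \<psi> x) \<le> B"
  shows "cmod (partial_derivs js (\<lambda>x. \<phi> x * \<psi> x) x) \<le> 2 ^ length js * (A * B)"
  using assms
proof (induction js arbitrary: r \<phi> \<psi> rule: rev_induct)
  case Nil
  then show ?case using Nil(4,5)[of "[]"]
    by (auto simp: norm_mult intro!: mult_mono order_trans[OF norm_ge_zero])
next
  case (snoc i js)
  then obtain s where [simp]: "r = Suc s" by (cases r) auto
  have C: "C_r s (partial_deriv i \<phi>)" "C_r s (partial_deriv i \<psi>)" "C_r s \<phi>" "C_r s \<psi>" "length js \<le> s"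
    using snoc.prems C_r_SucD[of s] by auto
  have sub: "subseq ks (js @ [i])" "subseq (ks @ [i]) (js @ [i])" if "subseq ks js" for ks
    using that by (auto intro: subseq_rev_drop_many)
  have A: "cmod (partial_derivs ks \<phi> x) \<le> A" "cmod (partial_derivs ks (partial_deriv i \<phi>) x) \<le> A"
    if "subseq ks js" for ks
    using snoc.prems(4)[OF sub(1)[OF that]] snoc.prems(4)[OF sub(2)[OF that]] by auto
  have B: "cmod (partial_derivs ks \<psi> x) \<le> B" "cmod (partial_derivs ks (partial_deriv i \<psi>) x) \<le> B"
    if "subseq ks js" for ks
    using snoc.prems(5)[OF sub(1)[OF that]] snoc.prems(5)[OF sub(2)[OF that]] by auto
  have "partial_derivs (js @ [i]) (\<lambda>x. \<phi> x * \<psi> x) x =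
      partial_derivs js (\<lambda>x. partial_deriv i \<phi> x * \<psi> x) x
      + partial_derivs js (\<lambda>x. \<phi> x * partial_deriv i \<psi> x) x"
    using snoc.prems(1,2) C
    by (simp add: partial_deriv_mult[of s] partial_derivs_add[of s] C_r_mult del: C_r.simps)
  also have "cmod \<dots> \<le> 2 ^ length js * (A * B) + 2 ^ length js * (A * B)"
    by (rule norm_triangle_mono; rule snoc.IH[of s]) (use C A B in auto)
  also have "\<dots> = 2 ^ length (js @ [i]) * (A * B)" by simp
  finally show ?case .
qed

section \<open>Multi-indices as lists of directions\<close>

definition index_list :: "('n::finite \<Rightarrow> nat) \<Rightarrow> 'n list" where
  "index_list \<alpha> = concat (map (\<lambda>i. replicate (\<alpha> i) i) coordinates)"

text \<open>The norms control derivatives in these orders only: each list consists of blocks of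
  equal directions, arranged as in \<open>coordinates\<close>.\<close>

definition index_lists :: "nat \<Rightarrow> 'n::finite list set" where
  "index_lists r = index_list ` multi_indices r"

lemma multi_deriv_eq_partial_derivs: "multi_deriv \<alpha> \<phi> = partial_derivs (index_list \<alpha>) \<phi>"
proof -
  have "foldr (\<lambda>i. partial_deriv i ^^ \<alpha> i) xs \<phi>
      = foldr partial_deriv (concat (map (\<lambda>i. replicate (\<alpha> i) i) xs)) \<phi>" for xs
    by (induction xs) auto
  then show ?thesis by (simp add: multi_deriv_def partial_derivs_def index_list_def)
qed

lemma coordinates: "distinct (coordinates :: 'n::finite list)" "set (coordinates :: 'n list) = UNIV"
proof -
  have "\<exists>js. distinct js \<and> set js = (UNIV :: 'n set)"
    using finite_distinct_list[OF finite[of UNIV]] by blast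
  then have "distinct (coordinates :: 'n::finite list) \<and> set (coordinates :: 'n list) = UNIV"
    unfolding coordinates_def by (rule someI_ex)
  then show "distinct (coordinates :: 'n::finite list)" "set (coordinates :: 'n list) = UNIV" by auto
qed

lemma length_index_list: "length (index_list \<alpha>) = (\<Sum>i\<in>UNIV. \<alpha> i)"
  using coordinates[where 'n='a]
  by (simp add: index_list_def length_concat o_def sum_list_distinct_conv_sum_set)

lemma index_lists_length: "js \<in> index_lists r \<Longrightarrow> length js \<le> r"
  by (auto simp: index_lists_def length_index_list multi_indices_def)

lemma finite_index_lists: "finite (index_lists r)"
  by (rule finite_subset[OF _ finite_lists_length_le[of UNIV r]]) (auto dest: index_lists_length)

lemma Nil_in_index_lists [simp]: "[] \<in> index_lists r"
  unfolding index_lists_def by (rule image_eqI[of _ _ "\<lambda>_. 0"])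
    (auto simp: index_list_def multi_indices_def)

text \<open>A subsequence splits along the blocks, and a subsequence of copies of one element again
  consists of copies of it. So thinning out the blocks only lowers the multiplicities.\<close>

lemma subseq_concat_replicate:
  "distinct xs \<Longrightarrow> subseq js (concat (map (\<lambda>i. replicate (\<alpha> i) i) xs)) \<Longrightarrow>
    \<exists>\<beta>. js = concat (map (\<lambda>i. replicate (\<beta> i) i) xs)"
proof (induction xs arbitrary: js)
  case (Cons x xs)
  then obtain as bs where js: "js = as @ bs" and as: "subseq as (replicate (\<alpha> x) x)"
    and bs: "subseq bs (concat (map (\<lambda>i. replicate (\<alpha> i) i) xs))"
    by (auto elim!: subseq_appendE)
  obtain \<beta> where \<beta>: "bs = concat (map (\<lambda>i. replicate (\<beta> i) i) xs)"
    using Cons.IH[OF _ bs] Cons.prems(1) by auto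
  have "set as \<subseteq> set (replicate (\<alpha> x) x)" using as by (auto dest: list_emb_set)
  then have "replicate (length as) x = as" by (intro replicate_eqI[symmetric]) auto
  \<comment> \<open>By distinctness \<open>x\<close> does not occur in \<open>xs\<close>, so
    resetting the multiplicity at \<open>x\<close> leaves the later blocks alone.\<close>
  moreover have "map (\<lambda>i. replicate ((\<beta>(x := length as)) i) i) xs = map (\<lambda>i. replicate (\<beta> i) i) xs"
    using Cons.prems(1) by auto
  ultimately have "js = concat (map (\<lambda>i. replicate ((\<beta>(x := length as)) i) i) (x # xs))"
    using js \<beta> by (simp only: list.map concat.simps fun_upd_same)
  then show ?case by blast
qed auto

text \<open>This closure property makes the product estimate usable: every derivative of a factor
  that occurs in it is again one that the norms control.\<close>

lemma index_lists_subseq: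
  assumes "js \<in> index_lists r" "subseq ks js"
  shows "ks \<in> index_lists r"
proof -
  obtain \<alpha> where "js = index_list \<alpha>" using assms(1) by (auto simp: index_lists_def)
  then obtain \<beta> where \<beta>: "ks = index_list \<beta>"
    using subseq_concat_replicate[OF coordinates(1)] assms(2) unfolding index_list_def by blast
  have "length ks \<le> r"
    using list_emb_length[OF assms(2)] index_lists_length[OF assms(1)] by simp
  then show ?thesis
    by (auto simp: \<beta> length_index_list index_lists_def multi_indices_def)
qed

text \<open>A bound at a single point, stated as a predicate. Weights depending on the point can
  then be inserted later, and no supremum has to be shown finite on the way.\<close>

definition derivs_le :: "nat \<Rightarrow> (real^'n::finite \<Rightarrow> complex) \<Rightarrow> real^'n \<Rightarrow> real \<Rightarrow> bool" where
  "derivs_le r \<phi> x A \<longleftrightarrow> (\<forall>js\<in>index_lists r. cmod (partial_derivs js \<phi> x) \<le> A)"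

lemma derivs_le_iff_multi_deriv:
  "derivs_le r \<phi> x A \<longleftrightarrow> (\<forall>\<alpha>\<in>multi_indices r. cmod (multi_deriv \<alpha> \<phi> x) \<le> A)"
  by (auto simp: derivs_le_def index_lists_def multi_deriv_eq_partial_derivs)

lemma derivs_leD: "derivs_le r \<phi> x A \<Longrightarrow> cmod (\<phi> x) \<le> A"
  unfolding derivs_le_def by (metis Nil_in_index_lists partial_derivs_Nil)

lemma derivs_le_nonneg: "derivs_le r \<phi> x A \<Longrightarrow> 0 \<le> A"
  using derivs_leD norm_ge_zero order_trans by blast

lemma derivs_le_mono: "derivs_le r \<phi> x A \<Longrightarrow> A \<le> B \<Longrightarrow> derivs_le r \<phi> x B"
  by (force simp: derivs_le_def)

lemma derivs_le_add:
  assumes "C_r r \<phi>" "C_r r \<psi>" "derivs_le r \<phi> x A" "derivs_le r \<psi> x B"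
  shows "derivs_le r (\<lambda>x. \<phi> x + \<psi> x) x (A + B)"
  using assms(3,4)
  by (auto simp: derivs_le_def partial_derivs_add[OF assms(1,2)] index_lists_length
      intro!: norm_triangle_mono)

lemma derivs_le_cmult:
  assumes "C_r r \<phi>" "derivs_le r \<phi> x A"
  shows "derivs_le r (\<lambda>x. c * \<phi> x) x (cmod c * A)"
  using assms(2)
  by (auto simp: derivs_le_def partial_derivs_cmult[OF assms(1)] index_lists_length norm_mult
      intro!: mult_left_mono)

lemma derivs_le_diff:
  assumes "C_r r \<phi>" "C_r r \<psi>" "derivs_le r \<phi> x A" "derivs_le r \<psi> x B"
  shows "derivs_le r (\<lambda>x. \<phi> x - \<psi> x) x (A + B)"
  using derivs_le_add[OF assms(1) C_r_cmult[OF assms(2)] assms(3) derivs_le_cmult[OF assms(2,4), of "-1"]]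
  by simp

lemma derivs_le_mult:
  assumes "C_r r \<phi>" "C_r r \<psi>" "derivs_le r \<phi> x A" "derivs_le r \<psi> x B"
  shows "derivs_le r (\<lambda>x. \<phi> x * \<psi> x) x (2 ^ r * (A * B))"
  unfolding derivs_le_def
proof
  fix js :: "'a list" assume js: "js \<in> index_lists r"
  have "cmod (partial_derivs js (\<lambda>x. \<phi> x * \<psi> x) x) \<le> 2 ^ length js * (A * B)"
    using assms index_lists_subseq[OF js] index_lists_length[OF js]
    by (intro partial_derivs_mult_bound[of r]) (auto simp: derivs_le_def)
  also have "\<dots> \<le> 2 ^ r * (A * B)"
    using index_lists_length[OF js] assms(3,4)[THEN derivs_le_nonneg]
    by (intro mult_right_mono power_increasing) auto
  finally show "cmod (partial_derivs js (\<lambda>x. \<phi> x * \<psi> x) x) \<le> 2 ^ r * (A * B)" .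
qed

text \<open>A derivative of order j gains |c|^j with j anywhere from 0 to r. A majorant
  \<open>K\<close> of |c| that is at least 1 covers all orders by \<open>K ^ r\<close>: take
  \<open>K\<close> = 1 for contractions and \<open>K\<close> = |c| for expansions.\<close>

lemma derivs_le_affine:
  assumes "C_r r \<phi>" "derivs_le r \<phi> (c *\<^sub>R x + b) A" "\<bar>c\<bar> \<le> K" "1 \<le> K"
  shows "derivs_le r (\<lambda>x. \<phi> (c *\<^sub>R x + b)) x (K ^ r * A)"
  unfolding derivs_le_def
proof
  fix js :: "'a list" assume js: "js \<in> index_lists r"
  have "\<bar>c\<bar> ^ length js \<le> K ^ r"
    using index_lists_length[OF js] assms(3,4)
    by (meson abs_ge_zero order_trans power_increasing power_mono)
  then have "\<bar>c\<bar> ^ length js * cmod (partial_derivs js \<phi> (c *\<^sub>R x + b)) \<le> K ^ r * A"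
    using assms(2,4) js by (intro mult_mono) (auto simp: derivs_le_def)
  then show "cmod (partial_derivs js (\<lambda>x. \<phi> (c *\<^sub>R x + b)) x) \<le> K ^ r * A"
    by (simp add: partial_derivs_affine[OF assms(1) index_lists_length[OF js]] norm_mult norm_power)
qed

lemma derivs_le_eq_0_on_open:
  "open U \<Longrightarrow> (\<And>x. x \<in> U \<Longrightarrow> \<phi> x = 0) \<Longrightarrow> x \<in> U \<Longrightarrow> 0 \<le> A \<Longrightarrow> derivs_le r \<phi> x A"
  by (simp add: derivs_le_def partial_derivs_eq_0_on_open)

lemma derivs_le_const: "derivs_le r (\<lambda>x. c) x (cmod c)"
  unfolding derivs_le_def
proof
  fix js :: "'a list"
  show "cmod (partial_derivs js (\<lambda>x. c) x) \<le> cmod c"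
    by (cases "js = []") (simp_all add: partial_derivs_const)
qed

section \<open>A cutoff function of class \<open>C\<^sup>r\<close>\<close>

text \<open>Truncated powers have just the finite smoothness that a cutoff of class C^r calls for.
  An exponent of at least 2 makes the two one-sided derivatives at 0 agree.\<close>

lemma max_0_power_has_derivative:
  fixes t :: real
  shows "((\<lambda>t. max 0 t ^ Suc (Suc k)) has_derivative
    (\<lambda>h. real (Suc (Suc k)) * max 0 t ^ Suc k * h)) (at t)"
proof -
  have "((\<lambda>t. max 0 t ^ Suc (Suc k)) has_real_derivative real (Suc (Suc k)) * max 0 t ^ Suc k) (at t)"
  proof (cases t "0::real" rule: linorder_cases)
    case less
    have "((\<lambda>t. 0) has_real_derivative 0) (at t)" by simp
    then have "((\<lambda>t::real. max 0 t ^ Suc (Suc k)) has_real_derivative 0) (at t)"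
      by (rule has_field_derivative_transform_within_open[of _ _ _ "{..<0}"]) (use less in auto)
    then show ?thesis using less by simp
  next
    case equal
    have "((\<lambda>h::real. max 0 h ^ Suc k) \<longlongrightarrow> max 0 0 ^ Suc k) (at 0)"
      by (intro tendsto_intros)
    then have "((\<lambda>h::real. max 0 h ^ Suc k) \<longlongrightarrow> 0) (at 0)" by simp
    \<comment> \<open>At 0 the difference quotient is itself a truncated power with positive
      exponent, so it tends to 0.\<close>
    moreover have "\<forall>\<^sub>F h in at 0. max 0 h ^ Suc k = (max 0 (0 + h) ^ Suc (Suc k) - max 0 (0::real) ^ Suc (Suc k)) / h"
      by (auto simp: eventually_at max_def intro!: exI[of _ 1])
    ultimately show ?thesis
      unfolding equal DERIV_def by (auto elim: Lim_transform_eventually)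
  next
    case greater
    have "((\<lambda>t. t ^ Suc (Suc k)) has_real_derivative real (Suc (Suc k)) * t ^ Suc k) (at t)"
      by (rule derivative_eq_intros refl | simp)+
    then have "((\<lambda>t. max 0 t ^ Suc (Suc k)) has_real_derivative real (Suc (Suc k)) * t ^ Suc k) (at t)"
      by (rule has_field_derivative_transform_within_open[of _ _ _ "{0<..}"]) (use greater in auto)
    then show ?thesis using greater by simp
  qed
  then show ?thesis by (simp add: has_field_derivative_def)
qed

text \<open>The derivative of a truncated power is the next lower truncated power times a derivative
  of \<open>q\<close>, so the induction uses up one power for each order. The real function
  \<open>q\<close> is embedded by \<open>of_real\<close> because \<open>C_r\<close> concerns
  complex-valued functions.\<close>

lemma C_r_max_0_power:
  "C_r k (\<lambda>x. of_real (q x)) \<Longrightarrow> C_r k (\<lambda>x. of_real (max 0 (q x) ^ Suc k))"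
proof (induction k)
  case 0
  then have "continuous_on UNIV (\<lambda>x. Re (of_real (q x)))"
    by (intro continuous_on_Re) simp
  then show ?case by (auto intro!: continuous_intros)
next
  case (Suc k)
  define \<phi> where "\<phi> = (\<lambda>x. complex_of_real (q x))"
  let ?\<psi> = "\<lambda>x. complex_of_real (max 0 (q x) ^ Suc (Suc k))"
  have C: "C_r (Suc k) \<phi>" using Suc.prems by (simp only: \<phi>_def)
  have deriv: "(?\<psi> has_derivative (\<lambda>h. of_real (real (Suc (Suc k)) * max 0 (q x) ^ Suc k) *
      frechet_derivative \<phi> (at x) h)) (at x)" for x
  proof -
    have \<phi>': "(\<phi> has_derivative frechet_derivative \<phi> (at x)) (at x)"
      using C by (simp add: frechet_derivative_works)
    have q': "(q has_derivative (\<lambda>h. Re (frechet_derivative \<phi> (at x) h))) (at x)"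
      using bounded_linear.has_derivative[OF bounded_linear_Re \<phi>'] by (simp add: \<phi>_def)
    have "(\<phi> has_derivative (\<lambda>h. of_real (Re (frechet_derivative \<phi> (at x) h)))) (at x)"
      using bounded_linear.has_derivative[OF bounded_linear_of_real q'] by (simp add: \<phi>_def)
    \<comment> \<open>A real-valued function has a real derivative: both sides are derivatives of
      \<phi> at \<open>x\<close>, and derivatives are unique.\<close>
    then have eq: "(\<lambda>h. of_real (Re (frechet_derivative \<phi> (at x) h))) = frechet_derivative \<phi> (at x)"
      by (rule frechet_derivative_at)
    have "(?\<psi> has_derivative (\<lambda>h. of_real (real (Suc (Suc k)) * max 0 (q x) ^ Suc k *
        Re (frechet_derivative \<phi> (at x) h)))) (at x)"
      by (rule bounded_linear.has_derivative[OF bounded_linear_of_real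
            has_derivative_compose[OF q' max_0_power_has_derivative]])
    then show ?thesis using fun_cong[OF eq] by (simp only: of_real_mult)
  qed
  have "C_r k (partial_deriv i ?\<psi>)" for i
  proof -
    have eq: "partial_deriv i ?\<psi> = (\<lambda>x. of_nat (Suc (Suc k)) *
        (complex_of_real (max 0 (q x) ^ Suc k) * partial_deriv i \<phi> x))"
      unfolding has_derivative_partial_deriv[OF deriv, abs_def] partial_deriv_def of_real_mult
        of_real_of_nat_eq mult.assoc ..
    have "C_r k \<phi>" "C_r k (partial_deriv i \<phi>)" using C_r_SucD[OF C] C by simp_all
    then show ?thesis
      unfolding eq using Suc.IH by (intro C_r_cmult C_r_mult) (simp_all only: \<phi>_def)
  qed
  moreover have "?\<psi> differentiable (at x)" for x
    using deriv by (auto simp: differentiable_def)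
  ultimately show ?case unfolding C_r.simps by blast
qed

text \<open>The squared norm is a polynomial in the coordinates; the norm itself is not
  differentiable at the origin.\<close>

lemma C_r_norm_power2: "C_r r (\<lambda>x :: real^'n::finite. of_real ((norm x)\<^sup>2))"
proof -
  have coord: "C_r s (\<lambda>x :: real^'n. of_real (x $ j))" for j s
  proof (cases s)
    case (Suc s')
    have d: "((\<lambda>x :: real^'n. complex_of_real (x $ j)) has_derivative (\<lambda>h. of_real (h $ j))) (at x)" for x
      by (rule bounded_linear.has_derivative[OF bounded_linear_of_real
            bounded_linear.has_derivative[OF bounded_linear_vec_nth has_derivative_ident]])
    have "partial_deriv i (\<lambda>x :: real^'n. of_real (x $ j)) = (\<lambda>x. of_real (axis i 1 $ j))" for i
      by (rule ext, rule has_derivative_partial_deriv[OF d])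
    then show ?thesis using d by (auto simp: Suc C_r_const differentiable_def)
  qed (auto intro!: continuous_intros)
  have "C_r r (\<lambda>x :: real^'n. \<Sum>j\<in>UNIV. of_real (x $ j) * of_real (x $ j))"
    by (intro C_r_sum C_r_mult coord) simp
  moreover have "of_real ((norm x)\<^sup>2) = (\<Sum>j\<in>UNIV. complex_of_real (x $ j) * of_real (x $ j))"
    for x :: "real^'n"
    by (simp only: power2_norm_eq_inner inner_vec_def inner_real_def of_real_sum of_real_mult)
  ultimately show ?thesis by (simp only:)
qed

lemma derivs_le_compact_support:
  fixes \<phi> :: "real^'n::finite \<Rightarrow> complex"
  assumes "C_r r \<phi>" "\<And>x. norm x > R \<Longrightarrow> \<phi> x = 0"
  obtains E where "\<And>x. derivs_le r \<phi> x E"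
proof -
  have bound: "\<exists>E. \<forall>x. cmod (partial_derivs js \<phi> x) \<le> E" if "js \<in> index_lists r" for js
  proof -
    have "continuous_on (cball 0 R) (partial_derivs js \<phi>)"
      using continuous_on_subset[OF continuous_partial_derivs[OF assms(1) index_lists_length[OF that]]]
      by blast
    then have "bounded (partial_derivs js \<phi> ` cball 0 R)"
      by (intro compact_imp_bounded compact_continuous_image compact_cball)
    then obtain E where E: "\<And>x. x \<in> cball 0 R \<Longrightarrow> cmod (partial_derivs js \<phi> x) \<le> E"
      unfolding bounded_iff by blast
    \<comment> \<open>For negative \<open>R\<close> the ball is empty and \<open>E\<close> may be
      negative, while the zero derivatives outside the ball need a nonnegative bound.\<close>
    have "cmod (partial_derivs js \<phi> x) \<le> max E 0" for x
    proof (cases "x \<in> cball 0 R")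
      case True then show ?thesis using E by force
    next
      case False
      then have "partial_derivs js \<phi> x = 0"
        using assms(2) by (intro partial_derivs_eq_0_on_open[of "- cball 0 R"]) auto
      then show ?thesis by simp
    qed
    then show ?thesis by blast
  qed
  then obtain E where E: "\<And>js x. js \<in> index_lists r \<Longrightarrow> cmod (partial_derivs js \<phi> x) \<le> E js"
    by metis
  have "derivs_le r \<phi> x (Max (E ` index_lists r))" for x
    unfolding derivs_le_def using E finite_index_lists[of r]
    by (auto intro: order_trans[OF _ Max_ge])
  then show ?thesis using that by blast
qed

text \<open>Two nested truncated powers. The inner one, \<open>g\<close>, vanishes on the unit ball
  and is at least 1 beyond radius 2, where the squared norm minus 1 exceeds 1. The outer one, the
  truncated power of \<open>1 - g\<close>, turns these values into 1 and 0.\<close>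

lemma cutoff_exists:
  obtains \<eta> :: "real^'n::finite \<Rightarrow> complex" and E
  where "C_r r \<eta>" "\<And>x. norm x \<le> 1 \<Longrightarrow> \<eta> x = 1" "\<And>x. norm x > 2 \<Longrightarrow> \<eta> x = 0"
    "\<And>x. derivs_le r \<eta> x E"
proof -
  define g :: "real^'n \<Rightarrow> real" where "g = (\<lambda>x. max 0 ((norm x)\<^sup>2 - 1) ^ Suc r)"
  define \<eta> :: "real^'n \<Rightarrow> complex" where "\<eta> = (\<lambda>x. of_real (max 0 (1 - g x) ^ Suc r))"
  have "C_r r (\<lambda>x :: real^'n. of_real ((norm x)\<^sup>2) - 1)"
    by (intro C_r_diff C_r_norm_power2 C_r_const)
  then have "C_r r (\<lambda>x :: real^'n. of_real ((norm x)\<^sup>2 - 1))" by simp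
  then have "C_r r (\<lambda>x. of_real (g x))" unfolding g_def by (rule C_r_max_0_power)
  then have "C_r r (\<lambda>x. 1 - of_real (g x))" by (intro C_r_diff C_r_const)
  then have "C_r r (\<lambda>x. of_real (1 - g x))" by simp
  then have C: "C_r r \<eta>" unfolding \<eta>_def by (rule C_r_max_0_power)
  have 1: "\<eta> x = 1" if "norm x \<le> 1" for x
    using power_mono[OF that norm_ge_zero, of 2] by (simp add: \<eta>_def g_def)
  have 0: "\<eta> x = 0" if "norm x > 2" for x
  proof -
    have "2\<^sup>2 \<le> (norm x)\<^sup>2" by (rule power_mono) (use that in auto)
    then have "1 ^ Suc r \<le> max 0 ((norm x)\<^sup>2 - 1) ^ Suc r" by (intro power_mono) auto
    then show ?thesis by (simp add: \<eta>_def g_def)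
  qed
  obtain E where "\<And>x. derivs_le r \<eta> x E" using derivs_le_compact_support[OF C 0] by blast
  with that C 1 0 show ?thesis by blast
qed

section \<open>Weighted spaces\<close>

text \<open>The interface shared by the two spaces. \<open>weight_growth\<close> says that
  translating to the base point, contracting, and multiplying by a polynomial cost only a larger
  index of the weight. This is what test functions seen through \<open>dilate\<close>
  require.\<close>

locale weight_family =
  fixes w :: "nat \<Rightarrow> real^'n::finite \<Rightarrow> real"
  assumes weight_ge_1: "1 \<le> w l x"
    and weight_mono: "l \<le> m \<Longrightarrow> w l x \<le> w m x"
    and weight_growth:
      "\<exists>L C. \<forall>\<epsilon> z. \<bar>\<epsilon>\<bar> \<le> 1 \<longrightarrow> w l (x\<^sub>0 + \<epsilon> *\<^sub>R z) * (1 + norm z) ^ k \<le> C * w L z"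
begin

definition wspace :: "nat \<Rightarrow> (real^'n \<Rightarrow> complex) set" where
  "wspace r = {\<phi>. C_r r \<phi> \<and> (\<forall>l. bdd_above (weighted_values (w l) r \<phi>))}"

definition wnorm :: "nat \<Rightarrow> nat \<Rightarrow> (real^'n \<Rightarrow> complex) \<Rightarrow> real" where
  "wnorm r l \<phi> = Sup (weighted_values (w l) r \<phi>)"

text \<open>Plays the role of "the norm is at most \<open>A\<close>" without presupposing that the
  supremum is meaningful, so it can also be used to prove membership in
  \<open>wspace\<close>.\<close>

definition wbound :: "nat \<Rightarrow> nat \<Rightarrow> (real^'n \<Rightarrow> complex) \<Rightarrow> real \<Rightarrow> bool" where
  "wbound r l \<phi> A \<longleftrightarrow> (\<forall>x. derivs_le r \<phi> x (A / w l x))"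

lemma weight_pos: "0 < w l x"
  using weight_ge_1[of l x] by linarith

lemma weighted_values_le_iff: "(\<forall>v\<in>weighted_values (w l) r \<phi>. v \<le> A) \<longleftrightarrow> wbound r l \<phi> A"
  by (auto simp: weighted_values_def wbound_def derivs_le_iff_multi_deriv pos_le_divide_eq[OF weight_pos]
      mult.commute)

lemma weighted_values_nonempty: "weighted_values (w l) r \<phi> \<noteq> {}"
  unfolding weighted_values_def multi_indices_def by (auto intro!: exI[of _ "\<lambda>_. 0"])

lemma wspaceI: "C_r r \<phi> \<Longrightarrow> (\<And>l. \<exists>A. wbound r l \<phi> A) \<Longrightarrow> \<phi> \<in> wspace r"
  by (auto simp: wspace_def bdd_above_def weighted_values_le_iff)

lemma wspace_C_r: "\<phi> \<in> wspace r \<Longrightarrow> C_r r \<phi>"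
  by (simp add: wspace_def)

lemma wbound_wnorm: "\<phi> \<in> wspace r \<Longrightarrow> wbound r l \<phi> (wnorm r l \<phi>)"
  unfolding weighted_values_le_iff[symmetric] wnorm_def wspace_def by (auto intro: cSup_upper)

lemma wnorm_le: "wbound r l \<phi> A \<Longrightarrow> wnorm r l \<phi> \<le> A"
  unfolding weighted_values_le_iff[symmetric] wnorm_def
  by (intro cSup_least weighted_values_nonempty) auto

lemma wbound_mono: "wbound r l \<phi> A \<Longrightarrow> A \<le> B \<Longrightarrow> wbound r l \<phi> B"
  by (auto simp: wbound_def elim!: derivs_le_mono intro!: divide_right_mono less_imp_le[OF weight_pos])

lemma wboundD: "wbound r l \<phi> A \<Longrightarrow> derivs_le r \<phi> x (A / w l x)"
  by (simp add: wbound_def)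

lemma wbound_nonneg: "wbound r l \<phi> A \<Longrightarrow> 0 \<le> A"
  using derivs_le_nonneg[OF wboundD[of r l \<phi> A 0]] weight_pos[of l 0] by (simp add: zero_le_divide_iff)

lemma wbound_index_mono:
  assumes "wbound r m \<phi> A" "l \<le> m"
  shows "wbound r l \<phi> A"
  unfolding wbound_def
proof
  fix x
  have "A / w m x \<le> A / w l x"
    using wbound_nonneg[OF assms(1)] weight_mono[OF assms(2), of x] weight_pos[of l x]
    by (intro divide_left_mono) auto
  then show "derivs_le r \<phi> x (A / w l x)"
    by (rule derivs_le_mono[OF wboundD[OF assms(1)]])
qed

lemma wbound_add:
  assumes "C_r r \<phi>" "C_r r \<psi>" "wbound r l \<phi> A" "wbound r l \<psi> B"
  shows "wbound r l (\<lambda>x. \<phi> x + \<psi> x) (A + B)"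
  using assms(3,4) by (auto simp: wbound_def add_divide_distrib intro!: derivs_le_add assms(1,2))

lemma wbound_cmult:
  assumes "C_r r \<phi>" "wbound r l \<phi> A"
  shows "wbound r l (\<lambda>x. c * \<phi> x) (cmod c * A)"
  using assms(2) by (auto simp: wbound_def times_divide_eq_right[symmetric]
      simp del: times_divide_eq_right intro!: derivs_le_cmult assms(1))

lemma wbound_mult:
  assumes "C_r r \<phi>" "C_r r \<psi>" "wbound r l \<phi> A" "\<And>x. derivs_le r \<psi> x B"
  shows "wbound r l (\<lambda>x. \<phi> x * \<psi> x) (2 ^ r * (A * B))"
  unfolding wbound_def
proof
  fix x
  show "derivs_le r (\<lambda>x. \<phi> x * \<psi> x) x (2 ^ r * (A * B) / w l x)"
    using derivs_le_mult[OF assms(1,2) _ assms(4)[of x], of "A / w l x"] assms(3) by (simp add: wbound_def)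
qed

lemma wspace_add: "\<phi> \<in> wspace r \<Longrightarrow> \<psi> \<in> wspace r \<Longrightarrow> (\<lambda>x. \<phi> x + \<psi> x) \<in> wspace r"
  by (blast intro: wspaceI C_r_add wspace_C_r wbound_add wbound_wnorm)

lemma wspace_cmult: "\<phi> \<in> wspace r \<Longrightarrow> (\<lambda>x. c * \<phi> x) \<in> wspace r"
  by (blast intro: wspaceI C_r_cmult wspace_C_r wbound_cmult wbound_wnorm)

lemma wspace_mult:
  "\<phi> \<in> wspace r \<Longrightarrow> C_r r \<psi> \<Longrightarrow> (\<And>x. derivs_le r \<psi> x B) \<Longrightarrow> (\<lambda>x. \<phi> x * \<psi> x) \<in> wspace r"
  by (blast intro: wspaceI C_r_mult wspace_C_r wbound_mult wbound_wnorm)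

section \<open>Dilated test functions\<close>

lemma C_r_dilation: "C_r r \<phi> \<Longrightarrow> C_r r (\<lambda>y. \<phi> ((1 / \<epsilon>) *\<^sub>R (y - x\<^sub>0)))"
  using C_r_affine[of r \<phi> "1 / \<epsilon>" "- ((1 / \<epsilon>) *\<^sub>R x\<^sub>0)"] by (simp add: scaleR_diff_right)

text \<open>With y = x0 + \<epsilon> z, the chain rule costs at most |\<epsilon>|^-r because
  |\<epsilon>| is at most 1. The growth condition trades the weight at \<open>y\<close> for the
  larger weight at \<open>z\<close> and gains (1 + |z|)^-k. As the function vanishes for |z| < R,
  this gain is at most (1 + R)^-k wherever it matters.\<close>

lemma wbound_dilation:
  assumes growth: "\<forall>\<epsilon> z. \<bar>\<epsilon>\<bar> \<le> 1 \<longrightarrow> w l (x\<^sub>0 + \<epsilon> *\<^sub>R z) * (1 + norm z) ^ k \<le> C * w L z"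
    and \<phi>: "C_r r \<phi>" "wbound r L \<phi> A" and \<epsilon>: "\<epsilon> \<noteq> 0" "\<bar>\<epsilon>\<bar> \<le> 1"
    and R: "0 \<le> R" "\<And>z. norm z < R \<Longrightarrow> \<phi> z = 0"
  shows "wbound r l (\<lambda>y. \<phi> ((1 / \<epsilon>) *\<^sub>R (y - x\<^sub>0))) (C * A / \<bar>\<epsilon>\<bar> ^ r / (1 + R) ^ k)"
  unfolding wbound_def
proof
  fix y
  define z where "z = (1 / \<epsilon>) *\<^sub>R (y - x\<^sub>0)"
  have y: "y = x\<^sub>0 + \<epsilon> *\<^sub>R z" using \<epsilon> by (simp add: z_def)
  define D where "D = C * A / (1 + R) ^ k / w l y"
  have A: "0 \<le> A" using \<phi>(2) by (rule wbound_nonneg)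
  have g: "w l y * (1 + norm z) ^ k \<le> C * w L z" using growth \<epsilon> y by blast
  moreover have "0 < w l y * (1 + norm z) ^ k"
    using weight_pos[of l y] by (intro mult_pos_pos zero_less_power) (auto simp: add_pos_nonneg)
  ultimately have "0 < C * w L z" by linarith
  then have C: "0 < C" using weight_pos[of L z] by (simp add: zero_less_mult_iff)
  have D: "0 \<le> D" using A C R(1) weight_pos[of l y] by (simp add: D_def)
  have "derivs_le r \<phi> z D"
  proof (cases "norm z < R")
    case True
    then show ?thesis
      by (intro derivs_le_eq_0_on_open[of "ball 0 R"]) (auto simp: R(2) D)
  next
    case False
    have "w l y * (1 + R) ^ k \<le> w l y * (1 + norm z) ^ k"
      using False R(1) weight_pos[of l y] by (intro mult_left_mono power_mono) auto
    with g have "w l y * (1 + R) ^ k \<le> C * w L z" by linarith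
    then have "A * (w l y * (1 + R) ^ k) \<le> A * (C * w L z)" using A by (rule mult_left_mono)
    then have "A / w L z \<le> D"
      using weight_pos[of L z] weight_pos[of l y] R(1)
      by (simp add: D_def divide_simps add_pos_nonneg mult_ac)
    then show ?thesis by (rule derivs_le_mono[OF wboundD[OF \<phi>(2)]])
  qed
  then have "derivs_le r \<phi> ((1 / \<epsilon>) *\<^sub>R y + - ((1 / \<epsilon>) *\<^sub>R x\<^sub>0)) D"
    by (simp add: z_def scaleR_diff_right)
  then have "derivs_le r (\<lambda>y. \<phi> ((1 / \<epsilon>) *\<^sub>R y + - ((1 / \<epsilon>) *\<^sub>R x\<^sub>0))) y ((1 / \<bar>\<epsilon>\<bar>) ^ r * D)"
    using \<epsilon> by (intro derivs_le_affine \<phi>(1)) auto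
  moreover have "(1 / \<bar>\<epsilon>\<bar>) ^ r * D = C * A / \<bar>\<epsilon>\<bar> ^ r / (1 + R) ^ k / w l y"
    by (simp add: D_def divide_inverse power_inverse mult_ac)
  ultimately show "derivs_le r (\<lambda>y. \<phi> ((1 / \<epsilon>) *\<^sub>R (y - x\<^sub>0))) y (C * A / \<bar>\<epsilon>\<bar> ^ r / (1 + R) ^ k / w l y)"
    by (simp add: scaleR_diff_right)
qed

lemma wspace_dilation:
  assumes "\<phi> \<in> wspace r" "\<epsilon> \<noteq> 0" "\<bar>\<epsilon>\<bar> \<le> 1"
  shows "(\<lambda>y. \<phi> ((1 / \<epsilon>) *\<^sub>R (y - x\<^sub>0))) \<in> wspace r"
proof (rule wspaceI)
  show "C_r r (\<lambda>y. \<phi> ((1 / \<epsilon>) *\<^sub>R (y - x\<^sub>0)))"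
    using assms(1) by (intro C_r_dilation wspace_C_r)
  fix l
  \<comment> \<open>Only finiteness is at stake here, so exponent 0 and radius 0 are enough.\<close>
  obtain L C where "\<forall>\<epsilon> z. \<bar>\<epsilon>\<bar> \<le> 1 \<longrightarrow> w l (x\<^sub>0 + \<epsilon> *\<^sub>R z) * (1 + norm z) ^ 0 \<le> C * w L z"
    using weight_growth by blast
  from wbound_dilation[OF this wspace_C_r wbound_wnorm, of \<phi> r \<epsilon> 0] assms
  show "\<exists>A. wbound r l (\<lambda>y. \<phi> ((1 / \<epsilon>) *\<^sub>R (y - x\<^sub>0))) A" by auto
qed

lemma norms_boundedD:
  assumes "norms_bounded (wspace r) (wnorm r) B"
  obtains N where "N > 0" "\<And>\<phi>. \<phi> \<in> B \<Longrightarrow> wbound r l \<phi> N"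
proof -
  obtain N where "\<And>\<phi>. \<phi> \<in> B \<Longrightarrow> wnorm r l \<phi> \<le> N"
    using assms unfolding norms_bounded_def bdd_above_def by (metis image_eqI)
  then have "wbound r l \<phi> (max N 1)" if "\<phi> \<in> B" for \<phi>
    using assms that by (intro wbound_mono[OF wbound_wnorm]) (auto simp: norms_bounded_def le_max_iff_disj)
  then show ?thesis using that[of "max N 1"] by auto
qed

section \<open>From the topology to norm estimates\<close>

lemma wbound_zero: "wbound r l (\<lambda>x. 0) 0"
proof -
  have "derivs_le r (\<lambda>x :: real^'n. 0) x 0" for x
    using derivs_le_const[of r 0 x] by simp
  then show ?thesis by (simp add: wbound_def)
qed

lemma zero_in_wspace: "(\<lambda>x. 0) \<in> wspace r"
  using wbound_zero by (blast intro: wspaceI C_r_const)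

lemma wnorm_zero: "wnorm r l (\<lambda>x. 0) = 0"
  using wnorm_le[OF wbound_zero] wbound_nonneg[OF wbound_wnorm[OF zero_in_wspace]] by (rule antisym)

text \<open>The subbasis consists of balls around arbitrary centres. The triangle inequality
  recentres each ball that contains 0, and for finite intersections the monotonicity of the weights
  in the index lets a single norm suffice.\<close>

lemma zero_neighbourhood:
  assumes "openin (norms_topology (wspace r) (wnorm r)) U" "(\<lambda>x. 0) \<in> U"
  shows "\<exists>l e. 0 < e \<and> (\<forall>\<psi>\<in>wspace r. wbound r l \<psi> e \<longrightarrow> \<psi> \<in> U)"
proof -
  have "generate_topology_on
      {{\<psi>\<in>wspace r. wnorm r l (\<lambda>x. \<psi> x - \<phi> x) < e} | l \<phi> e. \<phi> \<in> wspace r \<and> e > 0} U"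
    using assms(1) unfolding norms_topology_def by (rule openin_topology_generated_by)
  then show ?thesis using assms(2)
  proof (induction rule: generate_topology_on.induct)
    case (Int a b)
    obtain l e where a: "0 < e" "\<And>\<psi>. \<psi> \<in> wspace r \<Longrightarrow> wbound r l \<psi> e \<Longrightarrow> \<psi> \<in> a"
      using Int.IH(1) Int.prems by auto
    obtain m d where b: "0 < d" "\<And>\<psi>. \<psi> \<in> wspace r \<Longrightarrow> wbound r m \<psi> d \<Longrightarrow> \<psi> \<in> b"
      using Int.IH(2) Int.prems by auto
    have "\<psi> \<in> a \<inter> b" if "\<psi> \<in> wspace r" "wbound r (max l m) \<psi> (min e d)" for \<psi>
      using that a b wbound_mono[OF wbound_index_mono[OF that(2)]] by auto
    then show ?case using a(1) b(1) by (intro exI[of _ "max l m"] exI[of _ "min e d"]) auto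
  next
    case (UN K)
    then obtain k where k: "k \<in> K" "(\<lambda>x. 0) \<in> k" by blast
    obtain l e where "0 < e" "\<forall>\<psi>\<in>wspace r. wbound r l \<psi> e \<longrightarrow> \<psi> \<in> k"
      using UN.IH[OF k] by blast
    then show ?case using k(1) by blast
  next
    case (Basis s)
    then obtain l \<phi> e where s: "s = {\<psi>\<in>wspace r. wnorm r l (\<lambda>x. \<psi> x - \<phi> x) < e}"
      and \<phi>: "\<phi> \<in> wspace r" "e > 0" by auto
    \<comment> \<open>\<open>a\<close> is the distance from 0 to the centre, which is below
      \<open>e\<close> since 0 lies in the ball. Half of the remaining radius gives the strict
      inequality although \<open>wbound\<close> is not strict.\<close>
    define a where "a = wnorm r l (\<lambda>x. - \<phi> x)"
    have m\<phi>: "(\<lambda>x. - \<phi> x) \<in> wspace r" using wspace_cmult[OF \<phi>(1), of "-1"] by simp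
    have a: "a < e" using Basis.prems by (auto simp: s a_def)
    have "\<psi> \<in> s" if \<psi>: "\<psi> \<in> wspace r" "wbound r l \<psi> ((e - a) / 2)" for \<psi>
    proof -
      have "wbound r l (\<lambda>x. \<psi> x + - \<phi> x) ((e - a) / 2 + a)"
        unfolding a_def using \<psi> m\<phi> by (intro wbound_add wspace_C_r wbound_wnorm) (auto simp: a_def)
      then have "wnorm r l (\<lambda>x. \<psi> x + - \<phi> x) \<le> (e - a) / 2 + a" by (rule wnorm_le)
      also have "\<dots> < e" using a by (simp add: field_simps)
      finally show ?thesis using \<psi>(1) by (simp add: s)
    qed
    then show ?case using a by (intro exI[of _ l] exI[of _ "(e - a) / 2"]) auto
  qed auto
qed

text \<open>Continuity at 0 bounds \<open>f\<close> by 1 on a small ball, and homogeneity extends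
  this to all functions. Scaling by a positive bound \<open>A\<close> instead of by the norm also
  covers functions of norm 0.\<close>

lemma norms_dual_bound:
  assumes f: "f \<in> norms_dual (wspace r) (wnorm r)"
  shows "\<exists>l C. C > 0 \<and> (\<forall>\<phi>\<in>wspace r. \<forall>A>0. wbound r l \<phi> A \<longrightarrow> cmod (f \<phi>) \<le> C * A)"
proof -
  let ?T = "norms_topology (wspace r) (wnorm r)"
  have hom: "f (\<lambda>x. c * \<phi> x) = c * f \<phi>" if "\<phi> \<in> wspace r" for c \<phi>
    using f that by (auto simp: norms_dual_def)
  have f0: "f (\<lambda>x. 0) = 0" using hom[OF zero_in_wspace, of 0] by simp
  have "openin ?T {\<phi> \<in> topspace ?T. f \<phi> \<in> ball 0 1}"
    using f by (intro openin_continuous_map_preimage[of _ euclidean]) (auto simp: norms_dual_def)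
  moreover have "(\<lambda>x. 0) \<in> topspace ?T"
    unfolding norms_topology_def topology_generated_by_topspace
  proof (rule UnionI)
    show "{\<psi>\<in>wspace r. wnorm r 0 (\<lambda>x. \<psi> x - 0) < 1} \<in>
        {{\<psi>\<in>wspace r. wnorm r l (\<lambda>x. \<psi> x - \<phi> x) < e} | l \<phi> e. \<phi> \<in> wspace r \<and> e > 0}"
      unfolding mem_Collect_eq
      by (rule exI[of _ 0], rule exI[of _ "\<lambda>x. 0"], rule exI[of _ 1]) (simp add: zero_in_wspace)
    show "(\<lambda>x. 0) \<in> {\<psi>\<in>wspace r. wnorm r 0 (\<lambda>x. \<psi> x - 0) < 1}"
      by (simp add: zero_in_wspace wnorm_zero)
  qed
  ultimately obtain l e where e: "0 < e"
    "\<And>\<psi>. \<psi> \<in> wspace r \<Longrightarrow> wbound r l \<psi> e \<Longrightarrow> \<psi> \<in> {\<phi> \<in> topspace ?T. f \<phi> \<in> ball 0 1}"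
    using zero_neighbourhood[of r "{\<phi> \<in> topspace ?T. f \<phi> \<in> ball 0 1}"] f0 by auto
  have "cmod (f \<phi>) \<le> (1 / e) * A" if \<phi>: "\<phi> \<in> wspace r" "A > 0" "wbound r l \<phi> A" for \<phi> A
  proof -
    define c where "c = complex_of_real (e / A)"
    have c: "cmod c = e / A" using e \<phi> by (simp add: c_def norm_divide)
    have "wbound r l (\<lambda>x. c * \<phi> x) (cmod c * A)"
      using \<phi> by (intro wbound_cmult wspace_C_r)
    then have "wbound r l (\<lambda>x. c * \<phi> x) e" using \<phi>(2) by (simp add: c)
    then have "cmod (f (\<lambda>x. c * \<phi> x)) < 1"
      using e(2)[OF wspace_cmult[OF \<phi>(1)]] by simp
    then have "(e / A) * cmod (f \<phi>) < 1" using hom[OF \<phi>(1)] by (simp add: norm_mult c)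
    then show ?thesis using e(1) \<phi>(2) by (simp add: field_simps)
  qed
  then show ?thesis using e(1) by (intro exI[of _ l] exI[of _ "1 / e"]) auto
qed

end

section \<open>Dyadic decomposition\<close>

lemma D_r_boundedI:
  fixes B :: "(real^'n::finite \<Rightarrow> complex) set"
  assumes "\<And>\<phi>. \<phi> \<in> B \<Longrightarrow> C_r r \<phi>"
    and zero: "\<And>\<phi> x. \<phi> \<in> B \<Longrightarrow> norm x > R \<Longrightarrow> \<phi> x = 0"
    and bound: "\<And>\<phi> x. \<phi> \<in> B \<Longrightarrow> derivs_le r \<phi> x C"
  shows "D_r_bounded r B"
proof -
  have supp: "supp \<phi> \<subseteq> cball 0 R" if "\<phi> \<in> B" for \<phi>
    unfolding supp_def using zero[OF that] by (intro closure_minimal) (auto simp: not_less[symmetric])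
  have "compact (supp \<phi>)" if "\<phi> \<in> B" for \<phi>
    using compact_Int_closed[OF compact_cball, of "supp \<phi>" 0 R] supp[OF that]
    by (simp add: supp_def inf.absorb2)
  then have "B \<subseteq> D_r_space r" using assms(1) by (auto simp: D_r_space_def)
  moreover have "\<exists>K. compact K \<and> (\<forall>\<phi>\<in>B. supp \<phi> \<subseteq> K)"
    using supp by (intro exI[of _ "cball 0 R"]) auto
  moreover have "\<exists>C. \<forall>\<phi>\<in>B. \<forall>\<alpha>\<in>multi_indices r. \<forall>x. cmod (multi_deriv \<alpha> \<phi> x) \<le> C"
    using bound by (auto simp: derivs_le_iff_multi_deriv)
  ultimately show ?thesis by (auto simp: D_r_bounded_def)
qed

context weight_family
begin

section \<open>Polynomial growth of the weights and bounds on annuli\<close>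

lemma weight_growth_pos:
  obtains L C where "C > 0"
    "\<forall>\<epsilon> z. \<bar>\<epsilon>\<bar> \<le> 1 \<longrightarrow> w l (x\<^sub>0 + \<epsilon> *\<^sub>R z) * (1 + norm z) ^ k \<le> C * w L z"
proof -
  obtain L C where growth:
    "\<forall>\<epsilon> z. \<bar>\<epsilon>\<bar> \<le> 1 \<longrightarrow> w l (x\<^sub>0 + \<epsilon> *\<^sub>R z) * (1 + norm z) ^ k \<le> C * w L z"
    using weight_growth by blast
  have "C * w L z \<le> max C 1 * w L z" for z
    using weight_pos[of L z] by (intro mult_right_mono) auto
  with growth have "\<forall>\<epsilon> z. \<bar>\<epsilon>\<bar> \<le> 1 \<longrightarrow> w l (x\<^sub>0 + \<epsilon> *\<^sub>R z) * (1 + norm z) ^ k \<le> max C 1 * w L z"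
    by (meson order_trans)
  then show ?thesis using that[of "max C 1" L] by auto
qed

lemma weight_ge_power:
  obtains L C where "C > 0" "\<And>z. (1 + norm z) ^ k \<le> C * w L z"
proof -
  obtain L C where C: "C > 0" and
    growth: "\<forall>\<epsilon> z. \<bar>\<epsilon>\<bar> \<le> 1 \<longrightarrow> w 0 (0 + \<epsilon> *\<^sub>R z) * (1 + norm z) ^ k \<le> C * w L z"
    by (rule weight_growth_pos)
  have "(1 + norm z) ^ k \<le> C * w L z" for z
  proof -
    \<comment> \<open>At \<epsilon> = 0 the translated weight no longer depends on \<open>z\<close>
      and is at least 1, so the growth condition becomes a lower bound for the weight.\<close>
    have "1 * (1 + norm z) ^ k \<le> w 0 (0 + 0 *\<^sub>R z) * (1 + norm z) ^ k"
      by (intro mult_right_mono weight_ge_1) auto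
    also have "\<dots> \<le> C * w L z" using growth by (metis abs_zero zero_le_one)
    finally show ?thesis by simp
  qed
  with C that show ?thesis by blast
qed

text \<open>
  On the annulus that supports the cutoff, decay of order \<open>n + 1 + r\<close> beats the factor
  \<open>q ^ (n + 1)\<close> together with the factor \<open>q ^ r\<close> lost by differentiating \<open>\<phi> (q x)\<close>.
\<close>

lemma rescaled_annulus_bound:
  assumes growth: "\<And>z. (1 + norm z) ^ (n + 1 + r) \<le> C * w L z"
    and \<phi>: "C_r r \<phi>" "wbound r L \<phi> A"
    and \<eta>: "C_r r \<eta>" "\<And>x. norm x \<le> 1 \<Longrightarrow> \<eta> x = 1" "\<And>x. derivs_le r \<eta> x E"
    and q: "1 \<le> q"
  shows "derivs_le r (\<lambda>x. of_real (q ^ (n + 1)) * (\<phi> (q *\<^sub>R x) * (\<eta> x - \<eta> (2 *\<^sub>R x)))) x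
    (2 ^ r * (C * A * 2 ^ (n + 1 + r) * (E + 2 ^ r * E)))" (is "derivs_le r ?\<Psi> x ?K")
proof -
  have A: "0 \<le> A" using \<phi>(2) by (rule wbound_nonneg)
  have E: "0 \<le> E" using \<eta>(3)[of 0] by (rule derivs_le_nonneg)
  have "0 < (1 + norm (0 :: real^'n)) ^ (n + 1 + r)" by simp
  then have "0 < C * w L 0" using growth[of 0] by linarith
  then have C: "0 < C" using weight_pos[of L 0] by (simp add: zero_less_mult_iff)
  have C_\<phi>: "C_r r (\<lambda>x. \<phi> (q *\<^sub>R x))" using C_r_affine[OF \<phi>(1), of q 0] by simp
  have C_2\<eta>: "C_r r (\<lambda>x. \<eta> (2 *\<^sub>R x))" using C_r_affine[OF \<eta>(1), of 2 0] by simp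
  have C_\<chi>: "C_r r (\<lambda>x. \<eta> x - \<eta> (2 *\<^sub>R x))" using C_2\<eta> \<eta>(1) by (rule C_r_diff[rotated])
  show ?thesis
  proof (cases "norm x < 1 / 2")
    \<comment> \<open>Here \<open>x\<close> and \<open>2 *\<^sub>R x\<close> both lie in the unit
      ball, so the two cutoffs equal 1 and cancel.\<close>
    case True
    then show ?thesis using A C E
      by (intro derivs_le_eq_0_on_open[of "ball 0 (1 / 2)"]) (auto simp: \<eta>(2))
  next
    case False
    \<comment> \<open>The factor \<open>q ^ r\<close> is the chain rule for \<phi>(q x). The
      quotient is the decay of \<phi> at q x, whose norm is at least q / 2.\<close>
    define P where "P = q ^ r * (C * A / (q / 2) ^ (n + 1 + r))"
    have "q * (1 / 2) \<le> q * norm x" using False q by (intro mult_left_mono) auto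
    moreover have "norm (q *\<^sub>R x) = q * norm x" using q by simp
    ultimately have "q / 2 \<le> 1 + norm (q *\<^sub>R x)" by linarith
    then have "(q / 2) ^ (n + 1 + r) \<le> (1 + norm (q *\<^sub>R x)) ^ (n + 1 + r)"
      using q by (intro power_mono) auto
    also note growth
    finally have "A * (q / 2) ^ (n + 1 + r) \<le> A * (C * w L (q *\<^sub>R x))"
      using A by (rule mult_left_mono)
    then have "A / w L (q *\<^sub>R x) \<le> C * A / (q / 2) ^ (n + 1 + r)"
      using weight_pos[of L "q *\<^sub>R x"] q by (simp add: divide_le_eq pos_le_divide_eq mult_ac)
    then have "derivs_le r \<phi> (q *\<^sub>R x + 0) (C * A / (q / 2) ^ (n + 1 + r))"
      using derivs_le_mono[OF wboundD[OF \<phi>(2)]] by simp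
    then have 1: "derivs_le r (\<lambda>x. \<phi> (q *\<^sub>R x)) x P"
      using derivs_le_affine[OF \<phi>(1), of q x 0 _ q] q unfolding P_def by (simp only: add_0_right abs_of_nonneg)
    have "derivs_le r (\<lambda>x. \<eta> (2 *\<^sub>R x)) x (2 ^ r * E)"
      using derivs_le_affine[OF \<eta>(1), of 2 x 0 E 2] \<eta>(3) by simp
    then have 2: "derivs_le r (\<lambda>x. \<eta> x - \<eta> (2 *\<^sub>R x)) x (E + 2 ^ r * E)"
      using C_2\<eta> \<eta>(1,3) by (intro derivs_le_diff)
    have "derivs_le r ?\<Psi> x (cmod (of_real (q ^ (n + 1))) * (2 ^ r * (P * (E + 2 ^ r * E))))"
      using C_\<phi> C_\<chi> 1 2 by (intro derivs_le_cmult derivs_le_mult C_r_mult)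
    moreover have "cmod (of_real (q ^ (n + 1))) * (2 ^ r * (P * (E + 2 ^ r * E))) = ?K"
    proof -
      have "q ^ (n + 1) * P = C * A * 2 ^ (n + 1 + r)"
        using q by (simp add: P_def power_divide power_add field_simps)
      moreover have "q ^ (n + 1) * (2 ^ r * (P * (E + 2 ^ r * E))) = 2 ^ r * (q ^ (n + 1) * P * (E + 2 ^ r * E))"
        by (simp only: mult_ac)
      ultimately have "q ^ (n + 1) * (2 ^ r * (P * (E + 2 ^ r * E))) = ?K" by (simp only:)
      then show ?thesis using q by (simp add: norm_mult norm_power)
    qed
    ultimately show ?thesis by (simp only:)
  qed
qed

end

text \<open>Of the n + 1 factors \<open>q\<close>, n cancel against the Jacobian in
  \<open>dilate\<close>. The surviving one means that a bound for the left side improves by 1/q on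
  the right. Homogeneity of \<open>g\<close> enters as the one instance needed.\<close>

lemma dilate_rescale:
  fixes \<psi> :: "real^'n::finite \<Rightarrow> complex"
  assumes "g (\<lambda>y. of_real (q ^ (CARD('n) + 1)) * \<psi> ((1 / \<epsilon>) *\<^sub>R (y - x\<^sub>0)))
      = of_real (q ^ (CARD('n) + 1)) * g (\<lambda>y. \<psi> ((1 / \<epsilon>) *\<^sub>R (y - x\<^sub>0)))"
    and "q > 0" "\<epsilon> \<noteq> 0"
  shows "dilate g x\<^sub>0 (q * \<epsilon>) (\<lambda>x. of_real (q ^ (CARD('n) + 1)) * \<psi> (q *\<^sub>R x))
      = of_real q * dilate g x\<^sub>0 \<epsilon> \<psi>"
proof -
  have "1 / \<bar>q * \<epsilon>\<bar> ^ CARD('n) * q ^ (CARD('n) + 1) = q * (1 / \<bar>\<epsilon>\<bar> ^ CARD('n))"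
    using assms(2,3) by (simp add: abs_mult power_mult_distrib field_simps)
  from arg_cong[OF this, of complex_of_real] show ?thesis
    using assms by (simp add: dilate_def mult.assoc[symmetric] flip: of_real_mult of_real_power) 
qed

text \<open>Models \<open>f\<close> minus the constant functional, so the point value is 0.
  Linearity is asked for on \<open>wspace\<close> only, as values outside carry no meaning, and
  continuity appears as the estimate of \<open>norms_dual_bound\<close>.\<close>

locale weighted_functional = weight_family w for w :: "nat \<Rightarrow> real^'n::finite \<Rightarrow> real" +
  fixes r :: nat and g :: "(real^'n \<Rightarrow> complex) \<Rightarrow> complex" and x\<^sub>0 :: "real^'n"
  assumes g_add: "\<phi> \<in> wspace r \<Longrightarrow> \<psi> \<in> wspace r \<Longrightarrow> g (\<lambda>x. \<phi> x + \<psi> x) = g \<phi> + g \<psi>"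
    and g_cmult: "\<phi> \<in> wspace r \<Longrightarrow> g (\<lambda>x. c * \<phi> x) = c * g \<phi>"
    and g_bound: "\<exists>l C. C > 0 \<and>
      (\<forall>\<phi>\<in>wspace r. \<forall>A>0. wbound r l \<phi> A \<longrightarrow> cmod (g \<phi>) \<le> C * A)"
    and g_point_value:
      "D_r_bounded r D \<Longrightarrow> uniform_limit D (dilate g x\<^sub>0) (\<lambda>_. 0) (at 0)"
begin

lemma dilate_add:
  assumes "\<phi> \<in> wspace r" "\<psi> \<in> wspace r" "\<epsilon> \<noteq> 0" "\<bar>\<epsilon>\<bar> \<le> 1"
  shows "dilate g x\<^sub>0 \<epsilon> (\<lambda>x. \<phi> x + \<psi> x) = dilate g x\<^sub>0 \<epsilon> \<phi> + dilate g x\<^sub>0 \<epsilon> \<psi>"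
  using g_add[OF wspace_dilation[OF assms(1,3,4)] wspace_dilation[OF assms(2,3,4)]]
  by (simp add: dilate_def distrib_left)

text \<open>The exponent of |\<epsilon>| collects n from the definition of \<open>dilate\<close> and
  r from the chain rule. The constant is uniform in the multiplier \<open>m\<close> and its radius
  \<open>R\<close>, so that \<open>R\<close> may later be chosen in terms of \<epsilon>. For
  \<open>R\<close> of size 1/|\<epsilon>| one factor |\<epsilon>| is left.\<close>

lemma tail_bound:
  assumes B: "norms_bounded (wspace r) (wnorm r) B"
  obtains K where "K > 0" "\<And>\<phi> m R \<epsilon>. \<phi> \<in> B \<Longrightarrow> C_r r m \<Longrightarrow> (\<And>x. derivs_le r m x E) \<Longrightarrow>
      0 \<le> R \<Longrightarrow> (\<And>x. norm x < R \<Longrightarrow> m x = 0) \<Longrightarrow> \<epsilon> \<noteq> 0 \<Longrightarrow> \<bar>\<epsilon>\<bar> \<le> 1 \<Longrightarrow>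
      cmod (dilate g x\<^sub>0 \<epsilon> (\<lambda>x. \<phi> x * m x))
        \<le> K / (\<bar>\<epsilon>\<bar> ^ (CARD('n) + r) * (1 + R) ^ (CARD('n) + 1 + r))"
proof -
  let ?k = "CARD('n) + 1 + r"
  obtain l Cg where Cg: "Cg > 0"
    "\<And>\<phi> A. \<phi> \<in> wspace r \<Longrightarrow> A > 0 \<Longrightarrow> wbound r l \<phi> A \<Longrightarrow> cmod (g \<phi>) \<le> Cg * A"
    using g_bound by blast
  obtain L C where C: "C > 0" and
    growth: "\<forall>\<epsilon> z. \<bar>\<epsilon>\<bar> \<le> 1 \<longrightarrow> w l (x\<^sub>0 + \<epsilon> *\<^sub>R z) * (1 + norm z) ^ ?k \<le> C * w L z"
    by (rule weight_growth_pos)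
  obtain N where N: "N > 0" "\<And>\<phi>. \<phi> \<in> B \<Longrightarrow> wbound r L \<phi> N" using norms_boundedD[OF B] by blast
  \<comment> \<open>The continuity estimate asks for a positive bound, whereas \<open>E\<close> may
    be 0.\<close>
  define A where "A = 2 ^ r * (N * max E 1)"
  have A: "A > 0" using N(1) by (simp add: A_def)
  show ?thesis
  proof (rule that[of "Cg * C * A"])
    show "Cg * C * A > 0" using Cg(1) C A by simp
    fix \<phi> m :: "real^'n \<Rightarrow> complex" and R \<epsilon> :: real
    assume \<phi>: "\<phi> \<in> B" and m: "C_r r m" "\<And>x. derivs_le r m x E"
      and R: "0 \<le> R" "\<And>x. norm x < R \<Longrightarrow> m x = 0" and \<epsilon>: "\<epsilon> \<noteq> 0" "\<bar>\<epsilon>\<bar> \<le> 1"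
    have \<phi>X: "\<phi> \<in> wspace r" using \<phi> B by (auto simp: norms_bounded_def)
    have X: "(\<lambda>x. \<phi> x * m x) \<in> wspace r" using \<phi>X m by (rule wspace_mult)
    have "wbound r L (\<lambda>x. \<phi> x * m x) A"
      unfolding A_def using wspace_C_r[OF \<phi>X] m N(2)[OF \<phi>]
      by (intro wbound_mult derivs_le_mono[OF m(2)]) auto
    then have "wbound r l (\<lambda>y. \<phi> ((1 / \<epsilon>) *\<^sub>R (y - x\<^sub>0)) * m ((1 / \<epsilon>) *\<^sub>R (y - x\<^sub>0)))
        (C * A / \<bar>\<epsilon>\<bar> ^ r / (1 + R) ^ ?k)"
      using R \<epsilon> wspace_C_r[OF X] by (intro wbound_dilation[OF growth, of r "\<lambda>x. \<phi> x * m x"]) auto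
    then have "cmod (g (\<lambda>y. \<phi> ((1 / \<epsilon>) *\<^sub>R (y - x\<^sub>0)) * m ((1 / \<epsilon>) *\<^sub>R (y - x\<^sub>0))))
        \<le> Cg * (C * A / \<bar>\<epsilon>\<bar> ^ r / (1 + R) ^ ?k)"
      using C A R(1) \<epsilon> by (intro Cg(2) wspace_dilation[OF X]) auto
    then have "1 / \<bar>\<epsilon>\<bar> ^ CARD('n) * cmod (g (\<lambda>y. \<phi> ((1 / \<epsilon>) *\<^sub>R (y - x\<^sub>0)) * m ((1 / \<epsilon>) *\<^sub>R (y - x\<^sub>0))))
        \<le> 1 / \<bar>\<epsilon>\<bar> ^ CARD('n) * (Cg * (C * A / \<bar>\<epsilon>\<bar> ^ r / (1 + R) ^ ?k))"
      by (intro mult_left_mono) auto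
    also have "\<dots> = Cg * C * A / (\<bar>\<epsilon>\<bar> ^ (CARD('n) + r) * (1 + R) ^ ?k)"
      by (simp add: power_add mult_ac)
    finally show "cmod (dilate g x\<^sub>0 \<epsilon> (\<lambda>x. \<phi> x * m x))
        \<le> Cg * C * A / (\<bar>\<epsilon>\<bar> ^ (CARD('n) + r) * (1 + R) ^ ?k)"
      by (simp add: dilate_def norm_mult norm_divide norm_power)
  qed
qed

text \<open>The factor 2 - 1/2^J is the sum of 2^-j over j from 0 to J, one term per annulus. One
  \<delta> serves every \<open>J\<close> because each annulus is tested by a dilation 2^j \<epsilon>
  with |2^j \<epsilon>| at most \<delta>.\<close>

lemma cutoff_bound:
  assumes B: "norms_bounded (wspace r) (wnorm r) B" and "e > 0"
    and \<eta>: "C_r r \<eta>" "\<And>x. norm x \<le> 1 \<Longrightarrow> \<eta> x = 1" "\<And>x. norm x > 2 \<Longrightarrow> \<eta> x = 0"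
      "\<And>x. derivs_le r \<eta> x E"
  obtains \<delta> where "0 < \<delta>" "\<delta> \<le> 1" "\<And>\<phi> \<epsilon> J. \<phi> \<in> B \<Longrightarrow> \<epsilon> \<noteq> 0 \<Longrightarrow> 2 ^ J * \<bar>\<epsilon>\<bar> \<le> \<delta> \<Longrightarrow>
    cmod (dilate g x\<^sub>0 \<epsilon> (\<lambda>x. \<phi> x * \<eta> ((1 / 2 ^ J) *\<^sub>R x))) \<le> e * (2 - 1 / 2 ^ J)"
proof -
  let ?n = "CARD('n)"
  obtain L C where C: "C > 0" and growth: "\<And>z. (1 + norm z) ^ (?n + 1 + r) \<le> C * w L z"
    using weight_ge_power by blast
  obtain N where N: "N > 0" "\<And>\<phi>. \<phi> \<in> B \<Longrightarrow> wbound r L \<phi> N" using norms_boundedD[OF B] by blast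
  have BX: "\<phi> \<in> wspace r" if "\<phi> \<in> B" for \<phi> using B that by (auto simp: norms_bounded_def)
  \<comment> \<open>The annulus of outer scale \<open>q\<close> brought to unit size, with the
    multiplier that \<open>dilate_rescale\<close> expects. Collecting all real q from 1 on, together
    with the innermost piece, into a single bounded set \<open>D\<close> lets the point value
    condition be used once for all scales.\<close>
  define \<Psi> where "\<Psi> = (\<lambda>\<phi> q x. complex_of_real (q ^ (?n + 1)) * (\<phi> (q *\<^sub>R x) * (\<eta> x - \<eta> (2 *\<^sub>R x))))"
  define D where "D = {\<lambda>x. \<phi> x * \<eta> x | \<phi>. \<phi> \<in> B} \<union> {\<Psi> \<phi> q | \<phi> q. \<phi> \<in> B \<and> 1 \<le> q}"
  have "D_r_bounded r D"
  proof -
    define K where "K = 2 ^ r * (C * N * 2 ^ (?n + 1 + r) * (E + 2 ^ r * E))"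
    have "derivs_le r (\<lambda>x. \<phi> x * \<eta> x) x (2 ^ r * (N * E))" if "\<phi> \<in> B" for \<phi> x
    proof -
      have "N / w L x \<le> N" using N(1) weight_ge_1[of L x] by (simp add: divide_le_eq)
      then have "derivs_le r \<phi> x N" using derivs_le_mono[OF wboundD[OF N(2)[OF that]]] by blast
      then show ?thesis using \<eta> wspace_C_r[OF BX[OF that]] by (intro derivs_le_mult)
    qed
    moreover have "derivs_le r (\<Psi> \<phi> q) x K" if "\<phi> \<in> B" "1 \<le> q" for \<phi> q x
      unfolding \<Psi>_def K_def
      using rescaled_annulus_bound[OF growth wspace_C_r[OF BX[OF that(1)]] N(2)[OF that(1)] \<eta>(1,2,4) that(2)]
      by blast
    ultimately have "derivs_le r \<phi> x (max K (2 ^ r * (N * E)))" if "\<phi> \<in> D" for \<phi> x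
      using that by (auto simp: D_def intro: derivs_le_mono[OF _ max.cobounded1] derivs_le_mono[OF _ max.cobounded2])
    moreover have "C_r r \<phi>" if "\<phi> \<in> D" for \<phi>
    proof -
      have "C_r r (\<Psi> \<psi> q)" if "\<psi> \<in> B" for \<psi> q
        using C_r_affine[OF wspace_C_r[OF BX[OF that]], of q 0] C_r_affine[OF \<eta>(1), of 2 0] \<eta>(1)
        unfolding \<Psi>_def by (intro C_r_cmult C_r_mult C_r_diff) simp_all
      moreover have "C_r r (\<lambda>x. \<psi> x * \<eta> x)" if "\<psi> \<in> B" for \<psi>
        using \<eta>(1) wspace_C_r[OF BX[OF that]] by (intro C_r_mult)
      ultimately show ?thesis using that by (auto simp: D_def)
    qed
    moreover have "\<phi> x = 0" if "\<phi> \<in> D" "norm x > 2" for \<phi> x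
      using that by (auto simp: D_def \<Psi>_def \<eta>(3))
    ultimately show ?thesis by (rule D_r_boundedI[rotated 2])
  qed
  from uniform_limitD[OF g_point_value[OF this] \<open>e > 0\<close>]
  obtain d where d: "d > 0"
    "\<And>\<epsilon> \<psi>. \<epsilon> \<noteq> 0 \<Longrightarrow> \<bar>\<epsilon>\<bar> < d \<Longrightarrow> \<psi> \<in> D \<Longrightarrow> cmod (dilate g x\<^sub>0 \<epsilon> \<psi>) < e"
    by (auto simp: eventually_at)
  \<comment> \<open>Halving makes \<delta> strictly smaller than \<open>d\<close>, as
    \<open>d(2)\<close> requires; the bound 1 keeps all dilations within the range of
    \<open>wspace_dilation\<close>.\<close>
  define \<delta> where "\<delta> = min (d / 2) 1"
  have \<delta>: "0 < \<delta>" "\<delta> \<le> 1" "\<delta> < d" using d(1) by (auto simp: \<delta>_def)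
  have "cmod (dilate g x\<^sub>0 \<epsilon> (\<lambda>x. \<phi> x * \<eta> ((1 / 2 ^ J) *\<^sub>R x))) \<le> e * (2 - 1 / 2 ^ J)"
    if \<phi>: "\<phi> \<in> B" and \<epsilon>: "\<epsilon> \<noteq> 0" and J: "2 ^ J * \<bar>\<epsilon>\<bar> \<le> \<delta>" for \<phi> \<epsilon> J
    using J
  proof (induction J)
    case 0
    then have "cmod (dilate g x\<^sub>0 \<epsilon> (\<lambda>x. \<phi> x * \<eta> x)) < e"
      using \<phi> \<epsilon> \<delta> by (intro d(2)) (auto simp: D_def)
    then show ?case by simp
  next
    case (Suc J)
    define q where "q = (2::real) ^ Suc J"
    define cut where "cut = (\<lambda>j x. \<eta> ((1 / 2 ^ j) *\<^sub>R x))"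
    have q: "1 \<le> q" unfolding q_def by (rule one_le_power) simp
    have qe: "q * \<bar>\<epsilon>\<bar> \<le> \<delta>" using Suc.prems by (simp only: q_def)
    have "1 * \<bar>\<epsilon>\<bar> \<le> q * \<bar>\<epsilon>\<bar>" using q by (intro mult_right_mono) auto
    then have \<epsilon>1: "\<bar>\<epsilon>\<bar> \<le> 1" using qe \<delta> by linarith
    have cut: "C_r r (cut j)" "derivs_le r (cut j) x E" for j x
    proof -
      show "C_r r (cut j)" unfolding cut_def using C_r_affine[OF \<eta>(1), of "1 / 2 ^ j" 0] by simp
      show "derivs_le r (cut j) x E"
        unfolding cut_def using derivs_le_affine[OF \<eta>(1), of "1 / 2 ^ j" x 0 E 1] \<eta>(4) by simp
    qed
    \<comment> \<open>\<open>m\<close> is supported where 2^J <= |x| <= 2^(J+2), which division by q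
      = 2^(J+1) maps to the fixed annulus 1/2 <= |x| <= 2.\<close>
    define m where "m = (\<lambda>x. cut (Suc J) x - cut J x)"
    have "C_r r m" "\<And>x. derivs_le r m x (E + E)"
      unfolding m_def using C_r_diff[OF cut(1) cut(1)] derivs_le_diff[OF cut(1) cut(1) cut(2) cut(2)]
      by blast+
    then have m: "(\<lambda>x. \<phi> x * m x) \<in> wspace r" by (rule wspace_mult[OF BX[OF \<phi>]])
    have "dilate g x\<^sub>0 \<epsilon> (\<lambda>x. \<phi> x * cut (Suc J) x) = dilate g x\<^sub>0 \<epsilon> (\<lambda>x. \<phi> x * cut J x + \<phi> x * m x)"
      by (simp add: m_def algebra_simps)
    also have "\<dots> = dilate g x\<^sub>0 \<epsilon> (\<lambda>x. \<phi> x * cut J x) + dilate g x\<^sub>0 \<epsilon> (\<lambda>x. \<phi> x * m x)"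
      using cut \<epsilon> \<epsilon>1 by (intro dilate_add wspace_mult[OF BX[OF \<phi>]] m)
    finally have split: "dilate g x\<^sub>0 \<epsilon> (\<lambda>x. \<phi> x * cut (Suc J) x)
      = dilate g x\<^sub>0 \<epsilon> (\<lambda>x. \<phi> x * cut J x) + dilate g x\<^sub>0 \<epsilon> (\<lambda>x. \<phi> x * m x)" .
    have "2 ^ J * \<bar>\<epsilon>\<bar> \<le> 2 ^ Suc J * \<bar>\<epsilon>\<bar>" by simp
    then have IH: "cmod (dilate g x\<^sub>0 \<epsilon> (\<lambda>x. \<phi> x * cut J x)) \<le> e * (2 - 1 / 2 ^ J)"
      unfolding cut_def using Suc.prems by (intro Suc.IH) (rule order_trans)
    \<comment> \<open>At q x the cutoff of scale 2^(J+1) reads \<eta>(x), and the one of scale 2^J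
      reads \<eta>(2 x).\<close>
    have "\<Psi> \<phi> q = (\<lambda>x. complex_of_real (q ^ (?n + 1)) * (\<phi> (q *\<^sub>R x) * m (q *\<^sub>R x)))"
      using q by (simp add: \<Psi>_def m_def cut_def) (simp add: q_def)
    then have "dilate g x\<^sub>0 (q * \<epsilon>) (\<Psi> \<phi> q) = of_real q * dilate g x\<^sub>0 \<epsilon> (\<lambda>x. \<phi> x * m x)"
      using dilate_rescale[where \<psi>="\<lambda>x. \<phi> x * m x" and g=g and q=q and \<epsilon>=\<epsilon> and x\<^sub>0=x\<^sub>0]
        g_cmult[OF wspace_dilation[OF m \<epsilon> \<epsilon>1]] q \<epsilon> by simp
    moreover have "cmod (dilate g x\<^sub>0 (q * \<epsilon>) (\<Psi> \<phi> q)) < e"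
      using q \<epsilon> \<delta> qe \<phi> by (intro d(2)) (auto simp: D_def abs_mult)
    ultimately have "q * cmod (dilate g x\<^sub>0 \<epsilon> (\<lambda>x. \<phi> x * m x)) < e"
      using q by (simp add: norm_mult)
    then have "cmod (dilate g x\<^sub>0 \<epsilon> (\<lambda>x. \<phi> x * m x)) \<le> e / q" using q by (simp add: field_simps)
    with IH have "cmod (dilate g x\<^sub>0 \<epsilon> (\<lambda>x. \<phi> x * cut (Suc J) x)) \<le> e * (2 - 1 / 2 ^ J) + e / q"
      unfolding split by (rule norm_triangle_mono)
    also have "\<dots> = e * (2 - 1 / 2 ^ Suc J)" by (simp add: q_def field_simps)
    finally show ?case by (simp add: cut_def)
  qed
  with that \<delta> show ?thesis by blast
qed

lemma uniform_limit_dilate: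
  assumes B: "norms_bounded (wspace r) (wnorm r) B"
  shows "uniform_limit B (dilate g x\<^sub>0) (\<lambda>_. 0) (at 0)"
proof (rule uniform_limitI)
  fix e :: real assume e: "e > 0"
  let ?n = "CARD('n)" and ?k = "CARD('n) + 1 + r"
  obtain \<eta> :: "real^'n \<Rightarrow> complex" and E where \<eta>: "C_r r \<eta>" "\<And>x. norm x \<le> 1 \<Longrightarrow> \<eta> x = 1"
    "\<And>x. norm x > 2 \<Longrightarrow> \<eta> x = 0" "\<And>x. derivs_le r \<eta> x E"
    using cutoff_exists by blast
  \<comment> \<open>A quarter of \<open>e\<close> becomes at most half of it, since the geometric
    sum stays below 2.\<close>
  obtain \<delta> where \<delta>: "0 < \<delta>" "\<delta> \<le> 1" and inner: "\<And>\<phi> \<epsilon> J. \<phi> \<in> B \<Longrightarrow> \<epsilon> \<noteq> 0 \<Longrightarrow> 2 ^ J * \<bar>\<epsilon>\<bar> \<le> \<delta> \<Longrightarrow>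
    cmod (dilate g x\<^sub>0 \<epsilon> (\<lambda>x. \<phi> x * \<eta> ((1 / 2 ^ J) *\<^sub>R x))) \<le> e / 4 * (2 - 1 / 2 ^ J)"
    using cutoff_bound[OF B _ \<eta>, of "e / 4"] e by auto
  obtain K where K: "K > 0" and tail: "\<And>\<phi> m R \<epsilon>. \<phi> \<in> B \<Longrightarrow> C_r r m \<Longrightarrow> (\<And>x. derivs_le r m x (1 + E)) \<Longrightarrow>
      0 \<le> R \<Longrightarrow> (\<And>x. norm x < R \<Longrightarrow> m x = 0) \<Longrightarrow> \<epsilon> \<noteq> 0 \<Longrightarrow> \<bar>\<epsilon>\<bar> \<le> 1 \<Longrightarrow>
      cmod (dilate g x\<^sub>0 \<epsilon> (\<lambda>x. \<phi> x * m x)) \<le> K / (\<bar>\<epsilon>\<bar> ^ (?n + r) * (1 + R) ^ ?k)"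
    using tail_bound[OF B] by blast
  \<comment> \<open>The second entry is exactly what brings the tail bound K (2/\<delta>)^k
    |\<epsilon>| below e/2.\<close>
  define d where "d = min \<delta> (e / (2 * (K * (2 / \<delta>) ^ ?k)))"
  have d: "d > 0" using e K \<delta> by (simp add: d_def)
  have "dist (dilate g x\<^sub>0 \<epsilon> \<phi>) 0 < e" if \<phi>: "\<phi> \<in> B" and \<epsilon>: "\<epsilon> \<noteq> 0" "\<bar>\<epsilon>\<bar> < d" for \<epsilon> \<phi>
  proof -
    have \<epsilon>1: "\<bar>\<epsilon>\<bar> \<le> 1" and \<epsilon>\<delta>: "\<bar>\<epsilon>\<bar> \<le> \<delta>" using \<epsilon> \<delta> by (auto simp: d_def)
    have X: "\<phi> \<in> wspace r" using \<phi> B by (auto simp: norms_bounded_def)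
    have "\<exists>J. (2::real) ^ J \<le> \<delta> / \<bar>\<epsilon>\<bar> \<and> \<delta> / \<bar>\<epsilon>\<bar> < 2 ^ Suc J"
    proof -
      obtain J0 where J0: "\<delta> / \<bar>\<epsilon>\<bar> < (2::real) ^ J0" using real_arch_pow[of 2 "\<delta> / \<bar>\<epsilon>\<bar>"] by auto
      \<comment> \<open>Since |\<epsilon>| is at most \<delta>, exponent 0 does not exceed the
        quotient; the least exponent that does is therefore a successor, and \<open>J\<close> is its
        predecessor.\<close>
      have "\<not> \<delta> / \<bar>\<epsilon>\<bar> < (2::real) ^ 0" using \<epsilon> \<epsilon>\<delta> by (simp add: divide_less_eq)
      from ex_least_nat_less[OF J0 this] show ?thesis by (auto simp: not_less)
    qed
    then obtain J where J: "(2::real) ^ J \<le> \<delta> / \<bar>\<epsilon>\<bar>" "\<delta> / \<bar>\<epsilon>\<bar> < 2 ^ Suc J" by blast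
    define cut where "cut = (\<lambda>x. \<eta> ((1 / 2 ^ J) *\<^sub>R x))"
    have cut: "C_r r cut" "derivs_le r cut x E" for x
    proof -
      show "C_r r cut" unfolding cut_def using C_r_affine[OF \<eta>(1), of "1 / 2 ^ J" 0] by simp
      show "derivs_le r cut x E"
        unfolding cut_def using derivs_le_affine[OF \<eta>(1), of "1 / 2 ^ J" x 0 E 1] \<eta>(4) by simp
    qed
    have m: "C_r r (\<lambda>x. 1 - cut x)" "derivs_le r (\<lambda>x. 1 - cut x) x (1 + E)" for x
      using cut derivs_le_const[of r 1 x] by (auto intro!: C_r_diff C_r_const derivs_le_diff)
    have "2 ^ J * \<bar>\<epsilon>\<bar> \<le> \<delta>" using J(1) \<epsilon> by (simp add: pos_le_divide_eq)
    then have "cmod (dilate g x\<^sub>0 \<epsilon> (\<lambda>x. \<phi> x * cut x)) \<le> e / 4 * (2 - 1 / 2 ^ J)"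
      unfolding cut_def using \<phi> \<epsilon> by (intro inner)
    also have "\<dots> \<le> e / 4 * 2" using e by (intro mult_left_mono) auto
    finally have 1: "cmod (dilate g x\<^sub>0 \<epsilon> (\<lambda>x. \<phi> x * cut x)) \<le> e / 2" by simp
    have "cmod (dilate g x\<^sub>0 \<epsilon> (\<lambda>x. \<phi> x * (1 - cut x))) \<le> K / (\<bar>\<epsilon>\<bar> ^ (?n + r) * (1 + 2 ^ J) ^ ?k)"
    proof (rule tail[OF \<phi> m _ _ \<epsilon>(1) \<epsilon>1])
      fix x :: "real^'n" assume "norm x < 2 ^ J"
      then show "1 - cut x = 0" by (simp add: cut_def \<eta>(2) divide_le_eq)
    qed auto
    also have "\<dots> \<le> K * (2 / \<delta>) ^ ?k * \<bar>\<epsilon>\<bar>"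
    proof -
      have "\<delta> / (2 * \<bar>\<epsilon>\<bar>) \<le> 1 + 2 ^ J" using J(2) \<epsilon> by (simp add: field_simps)
      then have "(\<delta> / (2 * \<bar>\<epsilon>\<bar>)) ^ ?k \<le> (1 + 2 ^ J) ^ ?k" using \<delta> by (intro power_mono) auto
      then have "K / (\<bar>\<epsilon>\<bar> ^ (?n + r) * (1 + 2 ^ J) ^ ?k) \<le> K / (\<bar>\<epsilon>\<bar> ^ (?n + r) * (\<delta> / (2 * \<bar>\<epsilon>\<bar>)) ^ ?k)"
        using K \<epsilon> \<delta> by (intro divide_left_mono mult_left_mono mult_pos_pos) (auto simp: add_pos_pos)
      \<comment> \<open>The decay exponent exceeds n + r by one, so exactly one power of
        |\<epsilon>| survives.\<close>
      also have "\<dots> = K * (2 / \<delta>) ^ ?k * \<bar>\<epsilon>\<bar>"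
        using \<epsilon> \<delta> by (simp add: power_divide power_mult_distrib power_add field_simps)
      finally show ?thesis .
    qed
    also have "\<dots> < e / 2"
    proof -
      have P: "0 < K * (2 / \<delta>) ^ ?k" using K \<delta> by simp
      have "\<bar>\<epsilon>\<bar> < e / (2 * (K * (2 / \<delta>) ^ ?k))" using \<epsilon> by (simp add: d_def)
      then show ?thesis using P by (simp only: pos_less_divide_eq mult_pos_pos zero_less_numeral) (simp add: mult_ac)
    qed
    finally have 2: "cmod (dilate g x\<^sub>0 \<epsilon> (\<lambda>x. \<phi> x * (1 - cut x))) < e / 2" .
    have "dilate g x\<^sub>0 \<epsilon> (\<lambda>x. \<phi> x * cut x + \<phi> x * (1 - cut x))
        = dilate g x\<^sub>0 \<epsilon> (\<lambda>x. \<phi> x * cut x) + dilate g x\<^sub>0 \<epsilon> (\<lambda>x. \<phi> x * (1 - cut x))"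
      using cut m \<epsilon>(1) \<epsilon>1 by (intro dilate_add wspace_mult[OF X])
    then have "dilate g x\<^sub>0 \<epsilon> \<phi>
        = dilate g x\<^sub>0 \<epsilon> (\<lambda>x. \<phi> x * cut x) + dilate g x\<^sub>0 \<epsilon> (\<lambda>x. \<phi> x * (1 - cut x))"
      by (simp add: algebra_simps)
    with 1 2 show ?thesis
      using norm_triangle_ineq[of "dilate g x\<^sub>0 \<epsilon> (\<lambda>x. \<phi> x * cut x)" "dilate g x\<^sub>0 \<epsilon> (\<lambda>x. \<phi> x * (1 - cut x))"]
      by simp
  qed
  then show "\<forall>\<^sub>F \<epsilon> in at 0. \<forall>\<phi>\<in>B. dist (dilate g x\<^sub>0 \<epsilon> \<phi>) 0 < e"
    using d by (auto simp: eventually_at)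
qed

end

section \<open>Subtracting the constant functional\<close>

text \<open>The Jacobian produced here cancels the prefactor of \<open>dilate\<close>, so dilating
  the constant functional gives it back.\<close>

lemma lborel_integral_dilation:
  fixes \<phi> :: "real^'n::finite \<Rightarrow> complex"
  assumes "continuous_on UNIV \<phi>" "\<epsilon> \<noteq> 0"
  shows "(LINT y|lborel. \<phi> ((1 / \<epsilon>) *\<^sub>R (y - x\<^sub>0))) = of_real (\<bar>\<epsilon>\<bar> ^ CARD('n)) * (LINT x|lborel. \<phi> x)"
proof -
  define F where "F = (\<lambda>y. \<phi> ((1 / \<epsilon>) *\<^sub>R (y - x\<^sub>0)))"
  let ?D = "distr lborel borel (\<lambda>x. x\<^sub>0 + \<epsilon> *\<^sub>R x)"
  have "continuous_on UNIV F"
    unfolding F_def by (rule continuous_on_compose2[OF assms(1)]) (auto intro!: continuous_intros)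
  then have F [measurable]: "F \<in> borel_measurable borel" by (rule borel_measurable_continuous_onI)
  have "(LINT y|lborel. F y) = (LINT y|density ?D (\<lambda>_. \<bar>\<epsilon>\<bar> ^ DIM(real^'n)). F y)"
    using lborel_affine[OF assms(2), of x\<^sub>0] by simp
  also have "\<dots> = (LINT y|?D. \<bar>\<epsilon>\<bar> ^ DIM(real^'n) *\<^sub>R F y)"
    by (rule integral_density) auto
  also have "\<dots> = (LINT x|lborel. \<bar>\<epsilon>\<bar> ^ DIM(real^'n) *\<^sub>R F (x\<^sub>0 + \<epsilon> *\<^sub>R x))"
    by (rule integral_distr) auto
  also have "\<dots> = \<bar>\<epsilon>\<bar> ^ DIM(real^'n) *\<^sub>R (LINT x|lborel. \<phi> x)"
    using assms(2) by (simp add: F_def)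
  finally show ?thesis by (simp add: F_def scaleR_conv_of_real)
qed

text \<open>A majorant that factors over the coordinates: its integral is a power of the integral of
  1/(1 + t^2) over the line, which is finite.\<close>

lemma integrable_prod_inverse_1_plus_square:
  "integrable lborel (\<lambda>x :: real^'n::finite. \<Prod>b\<in>Basis. inverse (1 + (x \<bullet> b)\<^sup>2))"
proof (rule integrableI_nonneg)
  have "integrable lborel (\<lambda>t::real. inverse (1 + t\<^sup>2))"
    using integrable_inverse_1_plus_square by (simp add: set_integrable_def)
  then have "(\<integral>\<^sup>+t. ennreal (inverse (1 + t\<^sup>2)) \<partial>lborel) < \<infinity>"
    by (subst (asm) integrable_iff_bounded) auto
  then have "(\<Prod>b\<in>(Basis :: (real^'n) set). \<integral>\<^sup>+t. ennreal (inverse (1 + t\<^sup>2)) \<partial>lborel) < \<infinity>"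
    by (intro power_less_top_ennreal[THEN iffD2] | simp)+
  then show "(\<integral>\<^sup>+x. ennreal (\<Prod>b\<in>Basis. inverse (1 + ((x :: real^'n) \<bullet> b)\<^sup>2)) \<partial>lborel) < \<infinity>"
    by (subst (asm) nn_integral_lborel_prod[symmetric]) (auto simp: prod_ennreal)
qed (auto intro!: prod_nonneg AE_I2)

text \<open>Each of the n factors 1 + (coordinate)^2 is at most (1 + |x|)^2; hence the exponent
  2n.\<close>

lemma inverse_power_le_prod:
  fixes x :: "real^'n::finite"
  shows "1 / (1 + norm x) ^ (2 * CARD('n)) \<le> (\<Prod>b\<in>Basis. inverse (1 + (x \<bullet> b)\<^sup>2))"
proof -
  have "(\<Prod>b\<in>Basis. 1 + (x \<bullet> b)\<^sup>2) \<le> (\<Prod>b\<in>(Basis :: (real^'n) set). (1 + norm x)\<^sup>2)"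
  proof (rule prod_mono)
    fix b :: "real^'n" assume "b \<in> Basis"
    then have "\<bar>x \<bullet> b\<bar> \<le> norm x" by (rule Basis_le_norm)
    then have "(x \<bullet> b)\<^sup>2 \<le> (norm x)\<^sup>2" by (simp add: abs_le_square_iff[symmetric])
    then show "0 \<le> 1 + (x \<bullet> b)\<^sup>2 \<and> 1 + (x \<bullet> b)\<^sup>2 \<le> (1 + norm x)\<^sup>2"
    proof -
      have "(1 + norm x)\<^sup>2 = 1 + 2 * norm x + (norm x)\<^sup>2" by (simp add: power2_sum)
      then show ?thesis using \<open>(x \<bullet> b)\<^sup>2 \<le> (norm x)\<^sup>2\<close> norm_ge_zero[of x] zero_le_power2[of "x \<bullet> b"]
        by linarith
    qed
  qed
  also have "\<dots> = (1 + norm x) ^ (2 * CARD('n))" by (simp add: power_mult)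
  finally have "(\<Prod>b\<in>Basis. 1 + (x \<bullet> b)\<^sup>2) \<le> (1 + norm x) ^ (2 * CARD('n))" .
  moreover have "0 < (\<Prod>b\<in>Basis. 1 + (x \<bullet> b)\<^sup>2)" by (intro prod_pos) (auto simp: add_pos_nonneg)
  ultimately have "1 / (1 + norm x) ^ (2 * CARD('n)) \<le> 1 / (\<Prod>b\<in>Basis. 1 + (x \<bullet> b)\<^sup>2)"
    by (intro divide_left_mono mult_pos_pos) auto
  moreover have "(\<Prod>b\<in>Basis. inverse (1 + (x \<bullet> b)\<^sup>2)) = 1 / (\<Prod>b\<in>Basis. 1 + (x \<bullet> b)\<^sup>2)"
    using prod_inversef[of "\<lambda>b. 1 + (x \<bullet> b)\<^sup>2" Basis] by (simp add: o_def inverse_eq_divide)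
  ultimately show ?thesis by simp
qed

text \<open>Invariance of the constant functional makes the two distances equal for every \<epsilon>
  other than 0, and \<open>at 0\<close> ignores the exception. One direction transfers the
  hypothesis to the difference, the other brings the conclusion back.\<close>

lemma uniform_limit_dilate_diff_iff:
  assumes "\<And>\<phi>. \<phi> \<in> D \<Longrightarrow> continuous_on UNIV \<phi>"
  shows "uniform_limit D (dilate (\<lambda>\<phi>. f \<phi> - constant_functional \<gamma> \<phi>) x\<^sub>0) (\<lambda>_. 0) (at 0)
    \<longleftrightarrow> uniform_limit D (dilate f x\<^sub>0) (constant_functional \<gamma>) (at 0)"
proof -
  have "dilate (\<lambda>\<phi>. f \<phi> - constant_functional \<gamma> \<phi>) x\<^sub>0 \<epsilon> \<phi> = dilate f x\<^sub>0 \<epsilon> \<phi> - constant_functional \<gamma> \<phi>"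
    if "\<epsilon> \<noteq> 0" "\<phi> \<in> D" for \<epsilon> \<phi>
    using that lborel_integral_dilation[OF assms[OF that(2)] that(1), of x\<^sub>0]
    by (simp add: dilate_def constant_functional_def right_diff_distrib)
  then have "dist (dilate (\<lambda>\<phi>. f \<phi> - constant_functional \<gamma> \<phi>) x\<^sub>0 \<epsilon> \<phi>) 0
      = dist (dilate f x\<^sub>0 \<epsilon> \<phi>) (constant_functional \<gamma> \<phi>)" if "\<epsilon> \<noteq> 0" "\<phi> \<in> D" for \<epsilon> \<phi>
    using that by (simp add: dist_norm)
  then show ?thesis
    unfolding uniform_limit_iff eventually_at by (metis (no_types, lifting))
qed

context weight_family
begin

text \<open>Makes integration a continuous functional on \<open>wspace\<close>, so that subtracting
  a multiple of it keeps the continuity estimate.\<close>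

lemma wspace_integral_bound:
  "\<exists>l C. C > 0 \<and> (\<forall>\<phi>\<in>wspace r. integrable lborel \<phi> \<and>
    (\<forall>A>0. wbound r l \<phi> A \<longrightarrow> cmod (LINT x|lborel. \<phi> x) \<le> C * A))"
proof -
  let ?p = "\<lambda>x :: real^'n. \<Prod>b\<in>Basis. inverse (1 + (x \<bullet> b)\<^sup>2)"
  obtain L C where C: "C > 0" "\<And>z. (1 + norm z) ^ (2 * CARD('n)) \<le> C * w L z"
    using weight_ge_power by blast
  have le: "cmod (\<phi> x) \<le> (C * A) * ?p x" if "wbound r L \<phi> A" for \<phi> A x
  proof -
    have A: "0 \<le> A" using that by (rule wbound_nonneg)
    have "cmod (\<phi> x) \<le> A / w L x" by (rule derivs_leD[OF wboundD[OF that]])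
    also have "\<dots> \<le> C * A * (1 / (1 + norm x) ^ (2 * CARD('n)))"
    proof -
      have "A * (1 + norm x) ^ (2 * CARD('n)) \<le> A * (C * w L x)" using C(2) A by (rule mult_left_mono)
      moreover have "0 < (1 + norm x) ^ (2 * CARD('n))" by (intro zero_less_power add_pos_nonneg) auto
      ultimately show ?thesis using weight_pos[of L x]
        by (simp add: divide_le_eq pos_le_divide_eq mult_ac)
    qed
    also have "\<dots> \<le> C * A * ?p x"
      using C(1) A by (intro mult_left_mono inverse_power_le_prod) auto
    finally show ?thesis .
  qed
  have int: "integrable lborel \<phi>" if "\<phi> \<in> wspace r" "wbound r L \<phi> A" for \<phi> A
  proof (rule Bochner_Integration.integrable_bound)
    show "integrable lborel (\<lambda>x. (C * A) * ?p x)"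
      by (intro integrable_mult_right integrable_prod_inverse_1_plus_square)
    show "\<phi> \<in> borel_measurable lborel"
      using borel_measurable_continuous_onI[OF C_r_continuous[OF wspace_C_r[OF that(1)]]] by simp
    show "AE x in lborel. norm (\<phi> x) \<le> norm ((C * A) * ?p x)"
      using le[OF that(2)] by (intro AE_I2) (simp only: real_norm_def order_trans[OF _ abs_ge_self])
  qed
  define I where "I = (LINT x|lborel. ?p x)"
  have I: "0 \<le> I" unfolding I_def by (intro integral_nonneg_AE AE_I2 prod_nonneg) auto
  \<comment> \<open>\<open>I + 1\<close> in place of \<open>I\<close> yields a positive constant
    from nonnegativity alone.\<close>
  have bound: "cmod (LINT x|lborel. \<phi> x) \<le> (C * (I + 1)) * A"
    if "\<phi> \<in> wspace r" "A > 0" "wbound r L \<phi> A" for \<phi> A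
  proof -
    have "cmod (LINT x|lborel. \<phi> x) \<le> (LINT x|lborel. (C * A) * ?p x)"
      by (rule Bochner_Integration.integral_norm_bound_integral[OF int[OF that(1,3)] integrable_mult_right
            [OF integrable_prod_inverse_1_plus_square] le[OF that(3)]])
    also have "\<dots> = C * A * I" by (simp add: I_def)
    also have "\<dots> \<le> (C * (I + 1)) * A" using C(1) that(2) by (simp add: algebra_simps)
    finally show ?thesis .
  qed
  show ?thesis
    using C(1) I int[OF _ wbound_wnorm] bound by (intro exI[of _ L] exI[of _ "C * (I + 1)"]) simp
qed

proposition uniform_limit_point_value:
  assumes f: "f \<in> norms_dual (wspace r) (wnorm r)"
    and point_value: "has_point_value_of_order r f x\<^sub>0 \<gamma>"
    and B: "norms_bounded (wspace r) (wnorm r) B"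
  shows "uniform_limit B (dilate f x\<^sub>0) (constant_functional \<gamma>) (at 0)"
proof -
  define g where "g = (\<lambda>\<phi>. f \<phi> - constant_functional \<gamma> \<phi>)"
  obtain l1 C1 where f_bound: "C1 > 0"
    "\<forall>\<phi>\<in>wspace r. \<forall>A>0. wbound r l1 \<phi> A \<longrightarrow> cmod (f \<phi>) \<le> C1 * A"
    using norms_dual_bound[OF f] by blast
  obtain l2 C2 where int: "C2 > 0"
    "\<forall>\<phi>\<in>wspace r. integrable lborel \<phi> \<and>
      (\<forall>A>0. wbound r l2 \<phi> A \<longrightarrow> cmod (LINT x|lborel. \<phi> x) \<le> C2 * A)"
    using wspace_integral_bound by blast
  have integrable: "integrable lborel \<phi>" if "\<phi> \<in> wspace r" for \<phi>
    using int(2) that by blast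
  interpret weighted_functional w r g x\<^sub>0
  proof
    fix \<phi> \<psi> assume "\<phi> \<in> wspace r" "\<psi> \<in> wspace r"
    then show "g (\<lambda>x. \<phi> x + \<psi> x) = g \<phi> + g \<psi>"
      using f integrable by (simp add: g_def norms_dual_def constant_functional_def algebra_simps)
  next
    fix \<phi> c assume "\<phi> \<in> wspace r"
    then show "g (\<lambda>x. c * \<phi> x) = c * g \<phi>"
      using f integrable by (simp add: g_def norms_dual_def constant_functional_def algebra_simps)
  next
    have "cmod (g \<phi>) \<le> (C1 + cmod \<gamma> * C2) * A"
      if \<phi>: "\<phi> \<in> wspace r" "A > 0" "wbound r (max l1 l2) \<phi> A" for \<phi> A
    proof -
      have "cmod (f \<phi>) \<le> C1 * A"
        using f_bound(2) \<phi>(1,2) wbound_index_mono[OF \<phi>(3) max.cobounded1] by blast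
      moreover have "cmod (LINT x|lborel. \<phi> x) \<le> C2 * A"
        using int(2) \<phi>(1,2) wbound_index_mono[OF \<phi>(3) max.cobounded2] by blast
      then have "cmod (constant_functional \<gamma> \<phi>) \<le> cmod \<gamma> * (C2 * A)"
        by (simp add: constant_functional_def norm_mult mult_left_mono)
      ultimately show ?thesis
        using norm_triangle_ineq4[of "f \<phi>" "constant_functional \<gamma> \<phi>"] by (simp add: g_def algebra_simps)
    qed
    moreover have "C1 + cmod \<gamma> * C2 > 0" using f_bound(1) int(1) by (simp add: add_pos_nonneg)
    ultimately show "\<exists>l C. C > 0 \<and> (\<forall>\<phi>\<in>wspace r. \<forall>A>0. wbound r l \<phi> A \<longrightarrow> cmod (g \<phi>) \<le> C * A)"
      by blast
  next
    fix D :: "(real^'n \<Rightarrow> complex) set" assume D: "D_r_bounded r D"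
    then have "uniform_limit D (dilate f x\<^sub>0) (constant_functional \<gamma>) (at 0)"
      using point_value by (simp add: has_point_value_of_order_def)
    moreover have "continuous_on UNIV \<phi>" if "\<phi> \<in> D" for \<phi>
      using D that by (auto simp: D_r_bounded_def D_r_space_def intro: C_r_continuous)
    ultimately show "uniform_limit D (dilate g x\<^sub>0) (\<lambda>_. 0) (at 0)"
      unfolding g_def by (subst uniform_limit_dilate_diff_iff)
  qed
  have "continuous_on UNIV \<phi>" if "\<phi> \<in> B" for \<phi>
    using B that by (intro C_r_continuous[OF wspace_C_r]) (auto simp: norms_bounded_def)
  then show ?thesis
    using uniform_limit_dilate[OF B] unfolding g_def by (subst (asm) uniform_limit_dilate_diff_iff)
qed

end

section \<open>The two families of weights\<close>

text \<open>From 1 + |x0 + \<epsilon> z| <= (1 + |x0|)(1 + |z|): the first factor goes into the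
  constant, and the second raises the index from \<open>l\<close> to \<open>l + k\<close>.\<close>

lemma weight_family_S: "weight_family (S_weight :: nat \<Rightarrow> real^'n::finite \<Rightarrow> real)"
proof
  fix l m :: nat and x :: "real^'n"
  show "1 \<le> S_weight l x" by (simp add: S_weight_def)
  show "l \<le> m \<Longrightarrow> S_weight l x \<le> S_weight m x" by (simp add: S_weight_def power_increasing)
next
  fix l k :: nat and x\<^sub>0 :: "real^'n"
  have "S_weight l (x\<^sub>0 + \<epsilon> *\<^sub>R z) * (1 + norm z) ^ k \<le> (1 + norm x\<^sub>0) ^ l * S_weight (l + k) z"
    if "\<bar>\<epsilon>\<bar> \<le> 1" for \<epsilon> and z :: "real^'n"
  proof -
    have "norm (\<epsilon> *\<^sub>R z) \<le> norm z" using that by (simp add: mult_left_le_one_le)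
    then have "norm (x\<^sub>0 + \<epsilon> *\<^sub>R z) \<le> norm x\<^sub>0 + norm z"
      using norm_triangle_ineq[of x\<^sub>0 "\<epsilon> *\<^sub>R z"] by linarith
    moreover have "0 \<le> norm x\<^sub>0 * norm z" by simp
    ultimately have "1 + norm (x\<^sub>0 + \<epsilon> *\<^sub>R z) \<le> (1 + norm x\<^sub>0) * (1 + norm z)"
      unfolding distrib_left distrib_right by linarith
    then have "S_weight l (x\<^sub>0 + \<epsilon> *\<^sub>R z) \<le> ((1 + norm x\<^sub>0) * (1 + norm z)) ^ l"
      unfolding S_weight_def by (intro power_mono) auto
    then have "S_weight l (x\<^sub>0 + \<epsilon> *\<^sub>R z) * (1 + norm z) ^ k
        \<le> ((1 + norm x\<^sub>0) * (1 + norm z)) ^ l * (1 + norm z) ^ k"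
      by (intro mult_right_mono) auto
    then show ?thesis by (simp add: S_weight_def power_mult_distrib power_add mult_ac)
  qed
  then show "\<exists>L C. \<forall>\<epsilon> z. \<bar>\<epsilon>\<bar> \<le> 1 \<longrightarrow> S_weight l (x\<^sub>0 + \<epsilon> *\<^sub>R z) * (1 + norm z) ^ k \<le> C * S_weight L z"
    by blast
qed

text \<open>Superadditivity iterates to M(j a + s) >= j M(a), so \<open>M\<close> dominates a linear
  function with positive slope as soon as M(a) > 0, and an exponential of a linear function
  dominates every power.\<close>

lemma power_le_exp_weight:
  assumes M: "weight_function M"
  shows "\<exists>C. \<forall>t\<ge>0. (1 + t) ^ k \<le> C * exp (M t)"
proof -
  have superadd: "M t + M s \<le> M (t + s)" if "t \<ge> 0" "s \<ge> 0" for t s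
    using M that by (simp add: weight_function_def)
  have nonneg: "0 \<le> M t" if "t \<ge> 0" for t
    using M that by (simp add: weight_function_def)
  obtain a where a: "a \<ge> 0" "M a \<noteq> 0" using M by (auto simp: weight_function_def)
  have "M 0 = 0" using superadd[of 0 0] nonneg[of 0] by simp
  then have a0: "a > 0" using a by (cases "a = 0") auto
  have Ma: "M a > 0" using a nonneg[of a] by simp
  have linear: "real j * M a \<le> M (real j * a + s)" if "s \<ge> 0" for j s
  proof (induction j)
    case (Suc j)
    have "M a + M (real j * a + s) \<le> M (a + (real j * a + s))"
      using a that by (intro superadd) auto
    with Suc show ?case by (simp add: algebra_simps)
  qed (use nonneg that in simp)
  \<comment> \<open>Chosen so that (k + 1) c t = (t / a) M(a): the power k + 1 of exp(c t) then lies
    below exp(M(a) + M(t)). Using k + 1 instead of k keeps the denominator positive at k =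
    0.\<close>
  define c where "c = M a / (a * real (Suc k))"
  have c: "c > 0" using Ma a0 by (simp add: c_def)
  have "(1 + t) ^ k \<le> (max 1 (1 / c)) ^ Suc k * exp (M a) * exp (M t)" if t: "t \<ge> 0" for t
  proof -
    \<comment> \<open>Rounding t / a down loses at most one copy of M(a), which becomes the constant
      factor exp(M(a)).\<close>
    define j where "j = nat \<lfloor>t / a\<rfloor>"
    have ta: "0 \<le> t / a" using t a0 by simp
    have j: "real j \<le> t / a" "t / a \<le> real j + 1" using ta unfolding j_def by linarith+
    have "real j * a \<le> t" using j(1) a0 by (simp add: pos_le_divide_eq)
    then have "real j * M a \<le> M t" using linear[of "t - real j * a" j] by simp
    moreover have "t / a * M a \<le> (real j + 1) * M a" using j(2) Ma by (intro mult_right_mono) auto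
    ultimately have "t / a * M a \<le> M a + M t" by (simp add: algebra_simps)
    moreover have "real (Suc k) * (c * t) = t / a * M a" by (simp add: c_def del: of_nat_Suc)
    ultimately have Mt: "real (Suc k) * (c * t) \<le> M a + M t" by linarith
    have "1 * 1 + (1 / c) * (c * t) \<le> max 1 (1 / c) * 1 + max 1 (1 / c) * (c * t)"
      using c t by (intro add_mono mult_right_mono) auto
    then have "1 + t \<le> max 1 (1 / c) * (1 + c * t)" using c by (simp add: algebra_simps)
    also have "\<dots> \<le> max 1 (1 / c) * exp (c * t)" by (intro mult_left_mono exp_ge_add_one_self) auto
    finally have "(1 + t) ^ Suc k \<le> (max 1 (1 / c) * exp (c * t)) ^ Suc k"
      using t by (intro power_mono) auto
    also have "\<dots> = (max 1 (1 / c)) ^ Suc k * exp (real (Suc k) * (c * t))"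
      by (simp only: power_mult_distrib exp_of_nat_mult)
    also have "\<dots> \<le> (max 1 (1 / c)) ^ Suc k * exp (M a + M t)"
      using Mt by (intro mult_left_mono) auto
    finally have "(1 + t) ^ Suc k \<le> (max 1 (1 / c)) ^ Suc k * exp (M a) * exp (M t)"
      by (simp only: exp_add mult.assoc)
    moreover have "(1 + t) ^ k \<le> (1 + t) ^ Suc k" using t by (intro power_increasing) auto
    ultimately show ?thesis by linarith
  qed
  then show ?thesis by blast
qed

text \<open>The inequality with doubled arguments separates x0 from z and leaves M(2 l |z|). The
  polynomial costs a further M(|z|), and superadditivity merges the two into M((2 l + 1)|z|), so the
  new index is 2 l + 1.\<close>

lemma weight_family_K:
  assumes M: "weight_function M"
  shows "weight_family (K_weight M :: nat \<Rightarrow> real^'n::finite \<Rightarrow> real)"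
proof
  fix l m :: nat and x :: "real^'n"
  have mono: "M s \<le> M t" if "0 \<le> s" "s \<le> t" for s t
    using M that unfolding weight_function_def mono_on_def by force
  show "1 \<le> K_weight M l x" using M by (simp add: K_weight_def weight_function_def)
  show "l \<le> m \<Longrightarrow> K_weight M l x \<le> K_weight M m x"
    unfolding K_weight_def by (auto intro!: mono mult_right_mono)
next
  fix l k :: nat and x\<^sub>0 :: "real^'n"
  have mono: "M s \<le> M t" if "0 \<le> s" "s \<le> t" for s t
    using M that unfolding weight_function_def mono_on_def by force
  have sub: "M (t + s) \<le> M (2 * t) + M (2 * s)" and super: "M t + M s \<le> M (t + s)"
    if "t \<ge> 0" "s \<ge> 0" for t s
    using M that by (auto simp: weight_function_def)
  obtain C where C: "\<And>t. t \<ge> 0 \<Longrightarrow> (1 + t) ^ k \<le> C * exp (M t)"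
    using power_le_exp_weight[OF M] by blast
  have "K_weight M l (x\<^sub>0 + \<epsilon> *\<^sub>R z) * (1 + norm z) ^ k
      \<le> exp (M (2 * (real l * norm x\<^sub>0))) * C * K_weight M (2 * l + 1) z"
    if "\<bar>\<epsilon>\<bar> \<le> 1" for \<epsilon> and z :: "real^'n"
  proof -
    have "norm (\<epsilon> *\<^sub>R z) \<le> norm z" using that by (simp add: mult_left_le_one_le)
    then have "norm (x\<^sub>0 + \<epsilon> *\<^sub>R z) \<le> norm x\<^sub>0 + norm z"
      using norm_triangle_ineq[of x\<^sub>0 "\<epsilon> *\<^sub>R z"] by linarith
    then have "real l * norm (x\<^sub>0 + \<epsilon> *\<^sub>R z) \<le> real l * (norm x\<^sub>0 + norm z)"
      by (intro mult_left_mono) auto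
    then have "M (real l * norm (x\<^sub>0 + \<epsilon> *\<^sub>R z)) \<le> M (real l * norm x\<^sub>0 + real l * norm z)"
      by (intro mono) (auto simp: distrib_left)
    also have "\<dots> \<le> M (2 * (real l * norm x\<^sub>0)) + M (2 * (real l * norm z))" by (intro sub) auto
    finally have "K_weight M l (x\<^sub>0 + \<epsilon> *\<^sub>R z)
        \<le> exp (M (2 * (real l * norm x\<^sub>0)) + M (2 * (real l * norm z)))"
      by (simp add: K_weight_def)
    then have "K_weight M l (x\<^sub>0 + \<epsilon> *\<^sub>R z) * (1 + norm z) ^ k
        \<le> exp (M (2 * (real l * norm x\<^sub>0)) + M (2 * (real l * norm z))) * (C * exp (M (norm z)))"
      by (intro mult_mono C) auto
    also have "\<dots> = exp (M (2 * (real l * norm x\<^sub>0))) * C * exp (M (2 * (real l * norm z)) + M (norm z))"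
      by (simp add: exp_add mult_ac)
    also have "\<dots> \<le> exp (M (2 * (real l * norm x\<^sub>0))) * C * K_weight M (2 * l + 1) z"
    proof -
      have "0 < C * exp (M 0)" using C[of 0] by simp
      then have "0 \<le> C" by (simp add: zero_less_mult_iff)
      moreover have "M (2 * (real l * norm z)) + M (norm z) \<le> M (2 * (real l * norm z) + norm z)"
        by (intro super) auto
      then have "exp (M (2 * (real l * norm z)) + M (norm z)) \<le> K_weight M (2 * l + 1) z"
      proof -
        have "norm (real (2 * l + 1) *\<^sub>R z) = 2 * (real l * norm z) + norm z"
          unfolding norm_scaleR by (simp add: algebra_simps)
        with \<open>M (2 * (real l * norm z)) + M (norm z) \<le> M (2 * (real l * norm z) + norm z)\<close>
        show ?thesis unfolding K_weight_def by (simp only: exp_le_cancel_iff)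
      qed
      ultimately show ?thesis by (intro mult_left_mono) auto
    qed
    finally show ?thesis .
  qed
  then show "\<exists>L C. \<forall>\<epsilon> z. \<bar>\<epsilon>\<bar> \<le> 1 \<longrightarrow> K_weight M l (x\<^sub>0 + \<epsilon> *\<^sub>R z) * (1 + norm z) ^ k \<le> C * K_weight M L z"
    by blast
qed

theorem theorem4p2:
  fixes r :: nat and x\<^sub>0 :: "real^'n::finite" and \<gamma> :: complex
  shows
    "(\<forall>M f. weight_function M \<and> f \<in> K_dual M r \<and> has_point_value_of_order r f x\<^sub>0 \<gamma> \<longrightarrow>
        (\<forall>B. norms_bounded (K_space M r) (K_norm M r) B \<longrightarrow>
          uniform_limit B (dilate f x\<^sub>0) (constant_functional \<gamma>) (at 0))) \<and>
     (\<forall>f. f \<in> S_dual r \<and> has_point_value_of_order r f x\<^sub>0 \<gamma> \<longrightarrow>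
        (\<forall>B. norms_bounded (S_space r) (S_norm r) B \<longrightarrow>
          uniform_limit B (dilate f x\<^sub>0) (constant_functional \<gamma>) (at 0)))"
proof (intro conjI allI impI; elim conjE)
  fix M f and B :: "(real^'n \<Rightarrow> complex) set"
  assume M: "weight_function M"
    and *: "f \<in> K_dual M r" "has_point_value_of_order r f x\<^sub>0 \<gamma>" "norms_bounded (K_space M r) (K_norm M r) B"
  interpret weight_family "K_weight M :: nat \<Rightarrow> real^'n \<Rightarrow> real" using M by (rule weight_family_K)
  have "K_space M r = wspace r" "K_norm M r = wnorm r"
    by (auto simp: fun_eq_iff K_space_def wspace_def K_norm_def wnorm_def)
  with * show "uniform_limit B (dilate f x\<^sub>0) (constant_functional \<gamma>) (at 0)"
    using uniform_limit_point_value by simp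
next
  fix f and B :: "(real^'n \<Rightarrow> complex) set"
  assume *: "f \<in> S_dual r" "has_point_value_of_order r f x\<^sub>0 \<gamma>" "norms_bounded (S_space r) (S_norm r) B"
  interpret weight_family "S_weight :: nat \<Rightarrow> real^'n \<Rightarrow> real" by (rule weight_family_S)
  have "S_space r = wspace r" "S_norm r = wnorm r"
    by (auto simp: fun_eq_iff S_space_def wspace_def S_norm_def wnorm_def)
  with * show "uniform_limit B (dilate f x\<^sub>0) (constant_functional \<gamma>) (at 0)"
    using uniform_limit_point_value by simp
qed

end
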